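(* For any connected, simple, undirected graph $\mathcal{G}$ with vertex set $V$ and edge set $E$, the linear coefficient $\gamma_1$ of the $\gamma$-polynomial of the $h^*$-polynomial of the symmetric edge polytope $P_{\mathcal{G}}$ satisfies $\gamma_1=2g$, where $g=|E|-|V|+1$.
   Context: For $v\in V$ let $\mathbf{v}$ be the standard basis vector of $\mathbb{R}^V$, and $P_{\mathcal{G}}=\mathrm{conv}\{\mathbf{u}-\mathbf{v},\mathbf{v}-\mathbf{u}: uv\in E\}$. For a $d$-dimensional lattice polytope $P\subset\mathbb{R}^n$, the Ehrhart series $\sum_{k\ge0}|kP\cap\mathbb{Z}^n|t^k$ equals $h^*(t)/(1-t)^{d+1}$ for a polynomial $h^*$, the $h^*$-polynomial. It is known that the $h^*$-polynomial of $P_{\mathcal{G}}$ is palindromic of degree $D=|V|-1$, so it can be written uniquely as $h^*(x)=\sum_{i=0}^{\lfloor D/2\rfloor}\gamma_i\,x^i(1+x)^{D-2i}$; the polynomial $\sum_i\gamma_i y^i$ is its $\gamma$-polynomial. *)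

theory Defs
  imports "HOL-Analysis.Analysis" "HOL-Computational_Algebra.Polynomial_FPS"
begin

text \<open>The vertex set is the universe of a finite type \<open>'v\<close>, so that \<open>real ^ 'v\<close> is the space of
  real vectors indexed by the vertices; an edge is a two-element set of vertices.\<close>

definition simple_graph :: "'v::finite set set \<Rightarrow> bool" where
  "simple_graph E \<longleftrightarrow> (\<forall>e\<in>E. \<exists>u v. u \<noteq> v \<and> e = {u, v})"

definition connected_graph :: "'v::finite set set \<Rightarrow> bool" where
  "connected_graph E \<longleftrightarrow> (\<forall>u v. (u, v) \<in> {(x, y). {x, y} \<in> E}\<^sup>*)"

text \<open>Since \<open>{u, v} = {v, u}\<close>, every edge contributes both of its difference vectors.\<close>

definition symmetric_edge_polytope :: "'v::finite set set \<Rightarrow> (real ^ 'v) set" where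
  "symmetric_edge_polytope E = convex hull {axis u 1 - axis v 1 | u v. {u, v} \<in> E}"

definition ehrhart_series :: "(real ^ 'n::finite) set \<Rightarrow> real fps" where
  "ehrhart_series P =
     Abs_fps (\<lambda>k. real (card ((\<lambda>p. real k *\<^sub>R p) ` P \<inter> {x. \<forall>i. x $ i \<in> \<int>})))"

text \<open>The exponent is written \<open>nat (aff_dim P + 1)\<close> because \<open>aff_dim\<close> is an integer, with
  \<open>aff_dim {} = -1\<close>. The denominator has constant coefficient 1, so the division is the
  exact one of formal power series and \<open>h\<close> is unique.\<close>

definition h_star_polynomial :: "(real ^ 'n::finite) set \<Rightarrow> real poly" where
  "h_star_polynomial P =
     (THE h. ehrhart_series P = fps_of_poly h / (1 - fps_X) ^ nat (aff_dim P + 1))"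

text \<open>Intended for \<open>h\<close> with \<open>coeff h i = coeff h (D - i)\<close> and \<open>degree h \<le> D\<close>. The degree bound on \<open>g\<close> makes its coefficients exactly the coefficients of the expansion.\<close>

definition gamma_polynomial :: "nat \<Rightarrow> real poly \<Rightarrow> real poly" where
  "gamma_polynomial D h =
     (THE g. degree g \<le> D div 2 \<and>
        h = (\<Sum>i\<le>D div 2. smult (coeff g i) ([:0, 1:] ^ i * [:1, 1:] ^ (D - 2 * i))))"

end

theory Submission
  imports Defs
begin

text \<open>The lattice points of the dilates of the symmetric edge polytope are the integer vectors of
  coordinate sum 0, graded by the least cost of a nonnegative flow with that boundary on the
  directed edges. For costs that are a generic perturbation of the constant 1, a vector \<open>y\<close> with
  nonzero sum over every proper nonempty vertex set has a unique cheapest flow, whose support is a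
  directed spanning tree; its value on an edge \<open>a\<close> of the tree is the sum of \<open>y\<close> over the side of the
  fundamental cut of \<open>a\<close> that contains the head of \<open>a\<close>. These trees span a complete unimodular fan.
  Pushing every lattice point a little away from a root vertex \<open>r\<close>, or a little towards it, assigns
  it to exactly one half-open cone. So \<open>h\<^sup>*\<close> counts the trees by the number of edges directed
  towards \<open>r\<close>, and equally by the number directed away from \<open>r\<close>: it is palindromic. Its linear
  coefficient is \<open>2|E| - (|V| - 1)\<close>, since the lattice points of the polytope are 0 and the directed
  edges, and the term \<open>(1 + t)\<close> to the power \<open>|V| - 1\<close> accounts for a further \<open>|V| - 1\<close>.\<close>

subsection \<open>Spanning trees and flows\<close>

text \<open>For singletons \<open>S\<close> these are the entries of the signed incidence matrix;
  for larger \<open>S\<close>, sums of its rows.\<close>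

definition crossing :: "'v \<times> 'v \<Rightarrow> 'v set \<Rightarrow> int" where
  "crossing a S = of_bool (snd a \<in> S) - of_bool (fst a \<in> S)"

definition boundary :: "('v::finite \<times> 'v) set \<Rightarrow> ('v \<times> 'v \<Rightarrow> int) \<Rightarrow> 'v \<Rightarrow> int" where
  "boundary T z v = (\<Sum>a\<in>T. z a * crossing a {v})"

text \<open>Connectedness of the underlying undirected graph, phrased through cuts. In this form it
  follows at once from the nonvanishing of a boundary on proper vertex sets.\<close>

definition spanning :: "('v \<times> 'v) set \<Rightarrow> bool" where
  "spanning T \<longleftrightarrow> (\<forall>S. S \<noteq> {} \<and> S \<noteq> UNIV \<longrightarrow> (\<exists>a\<in>T. crossing a S \<noteq> 0))"

text \<open>The fundamental cut of \<open>a\<close>, oriented so that \<open>a\<close> enters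
  \<open>S\<close>.\<close>

definition is_cut :: "('v \<times> 'v) set \<Rightarrow> 'v \<times> 'v \<Rightarrow> 'v set \<Rightarrow> bool" where
  "is_cut T a S \<longleftrightarrow> (\<forall>b\<in>T. crossing b S = of_bool (b = a))"

text \<open>Acyclicity is expressed by requiring every arc to be a bridge, which supplies its
  fundamental cut directly.\<close>

definition spanning_tree :: "('v \<times> 'v) set \<Rightarrow> bool" where
  "spanning_tree T \<longleftrightarrow> spanning T \<and> (\<forall>a\<in>T. \<exists>S. is_cut T a S)"

definition tree_cut :: "('v \<times> 'v) set \<Rightarrow> 'v \<times> 'v \<Rightarrow> 'v set" where
  "tree_cut T a = (SOME S. is_cut T a S)"

lemma abs_crossing_le: "\<bar>crossing a S\<bar> \<le> 1"
  by (auto simp: crossing_def)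

lemma crossing_Compl: "crossing a (- S) = - crossing a S"
  by (auto simp: crossing_def)

lemma sum_crossing:
  fixes S :: "'v::finite set"
  shows "(\<Sum>v\<in>S. crossing a {v}) = crossing a S"
proof -
  have "(\<Sum>v\<in>S. of_bool (w = v)) = (of_bool (w \<in> S) :: int)" for w
    by (simp add: of_bool_def)
  then show ?thesis
    by (simp add: crossing_def sum_subtractf)
qed

lemma sum_boundary: "sum (boundary T z) S = (\<Sum>a\<in>T. z a * crossing a S)"
  unfolding boundary_def
  by (subst sum.swap) (simp add: sum_distrib_left [symmetric] sum_crossing)

lemma sum_boundary_UNIV: "sum (boundary T z) UNIV = 0"
  by (simp add: sum_boundary crossing_def)

lemma boundary_add: "boundary T (\<lambda>a. y a + z a) v = boundary T y v + boundary T z v"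
  by (simp add: boundary_def distrib_right sum.distrib)

lemma boundary_diff: "boundary T (\<lambda>a. y a - z a) v = boundary T y v - boundary T z v"
  by (simp add: boundary_def left_diff_distrib sum_subtractf)

lemma boundary_single:
  assumes "a \<in> T" "finite T"
  shows "boundary T (\<lambda>b. of_bool (b = a) * k) v = k * crossing a {v}"
proof -
  have "boundary T (\<lambda>b. of_bool (b = a) * k) v = (\<Sum>b\<in>T. if b = a then k * crossing a {v} else 0)"
    unfolding boundary_def by (intro sum.cong) auto
  with assms show ?thesis by simp
qed

text \<open>Serves as induction over a connected graph: a property that holds at \<open>u\<close>
  and passes both ways along every arc holds at all vertices.\<close>

lemma spanning_closed_UNIV:
  assumes "spanning T" "u \<in> R"
    and "\<And>a. a \<in> T \<Longrightarrow> fst a \<in> R \<longleftrightarrow> snd a \<in> R"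
  shows "R = UNIV"
proof (rule ccontr)
  assume "R \<noteq> UNIV"
  with assms(1,2) obtain a where "a \<in> T" "crossing a R \<noteq> 0"
    unfolding spanning_def by blast
  with assms(3) show False
    by (auto simp: crossing_def)
qed

text \<open>A unit flow from \<open>u\<close> to one end of an arc extends to the other end by
  adding or subtracting one unit on that arc. Signs are free here, so arcs may be traversed
  backwards.\<close>

lemma spanning_flow_pair:
  fixes u v :: "'v::finite"
  assumes "spanning T"
  shows "\<exists>z. \<forall>w. boundary T z w = crossing (u, v) {w}"
proof -
  let ?R = "{v. \<exists>z. \<forall>w. boundary T z w = crossing (u, v) {w}}"
  have step: "(\<exists>z. \<forall>w. boundary T z w = crossing (u, p) {w})
      \<longleftrightarrow> (\<exists>z. \<forall>w. boundary T z w = crossing (u, q) {w})" if "(p, q) \<in> T" for p q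
  proof -
    have single: "boundary T (\<lambda>b. of_bool (b = (p, q)) * 1) w = 1 * crossing (p, q) {w}" for w
      using that by (intro boundary_single) auto
    have *: "crossing (u, q) {w} = crossing (u, p) {w} + crossing (p, q) {w}" for w
      by (simp add: crossing_def)
    show ?thesis
    proof safe
      fix z assume "\<forall>w. boundary T z w = crossing (u, p) {w}"
      then show "\<exists>z. \<forall>w. boundary T z w = crossing (u, q) {w}"
        by (intro exI [of _ "\<lambda>b. z b + of_bool (b = (p, q)) * 1"])
          (use single in \<open>simp add: boundary_add *\<close>)
    next
      fix z assume "\<forall>w. boundary T z w = crossing (u, q) {w}"
      then show "\<exists>z. \<forall>w. boundary T z w = crossing (u, p) {w}"
        by (intro exI [of _ "\<lambda>b. z b - of_bool (b = (p, q)) * 1"])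
          (use single in \<open>simp add: boundary_diff *\<close>)
    qed
  qed
  have "?R = UNIV"
  proof (rule spanning_closed_UNIV [OF assms])
    show "u \<in> ?R"
      by (auto simp: boundary_def crossing_def intro!: exI [of _ "\<lambda>_. 0"])
  next
    fix a assume "a \<in> T"
    then show "fst a \<in> ?R \<longleftrightarrow> snd a \<in> ?R"
      using step [of "fst a" "snd a"] by simp
  qed
  then show ?thesis by auto
qed

text \<open>Superpose \<open>y v\<close> units of flow from a fixed vertex \<open>u\<close> to each
  \<open>v\<close>; what leaves \<open>u\<close> in total is \<open>sum y UNIV\<close>, which is
  0.\<close>

lemma spanning_flow:
  fixes y :: "'v::finite \<Rightarrow> int"
  assumes "spanning T" "sum y UNIV = 0"
  shows "\<exists>z. boundary T z = y"
proof -
  fix u :: 'v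
  obtain z where z: "\<And>v w. boundary T (z v) w = crossing (u, v) {w}"
    using spanning_flow_pair [OF assms(1), of u] by metis
  have "boundary T (\<lambda>a. \<Sum>v\<in>UNIV. y v * z v a) w = y w" for w
  proof -
    have "boundary T (\<lambda>a. \<Sum>v\<in>UNIV. y v * z v a) w = (\<Sum>v\<in>UNIV. y v * boundary T (z v) w)"
      unfolding boundary_def sum_distrib_right sum_distrib_left
      by (subst sum.swap) (simp only: mult.assoc)
    also have "\<dots> = (\<Sum>v\<in>UNIV. y v * of_bool (v = w)) - sum y UNIV * of_bool (u = w)"
      by (simp add: z crossing_def right_diff_distrib sum_subtractf sum_distrib_right)
    also have "\<dots> = y w"
      using assms(2) by (simp add: sum_mult_of_bool_eq)
    finally show ?thesis .
  qed
  then show ?thesis by blast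
qed

lemma spanning_tree_spanning: "spanning_tree T \<Longrightarrow> spanning T"
  by (simp add: spanning_tree_def)

lemma crossing_cut:
  assumes "spanning_tree T" "a \<in> T" "b \<in> T"
  shows "crossing b (tree_cut T a) = of_bool (b = a)"
proof -
  have "is_cut T a (tree_cut T a)"
    unfolding tree_cut_def using assms by (metis someI_ex spanning_tree_def)
  with assms show ?thesis by (simp add: is_cut_def)
qed

lemma cut_nontrivial:
  assumes "spanning_tree T" "a \<in> T"
  shows "tree_cut T a \<noteq> {}" "tree_cut T a \<noteq> UNIV"
  using crossing_cut [OF assms assms(2)] by (auto simp: crossing_def)

text \<open>Only \<open>a\<close> crosses its fundamental cut, so the net inflow into the cut is the
  flow on \<open>a\<close>. A flow on a tree is thus determined by its boundary.\<close>

lemma sum_boundary_cut: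
  fixes T :: "('v::finite \<times> 'v) set"
  assumes "spanning_tree T" "a \<in> T"
  shows "sum (boundary T z) (tree_cut T a) = z a"
proof -
  have "sum (boundary T z) (tree_cut T a) = (\<Sum>b\<in>T. z b * of_bool (b = a))"
    unfolding sum_boundary by (intro sum.cong) (simp_all add: crossing_cut assms)
  then show ?thesis
    using assms(2) by (simp add: sum_mult_of_bool_eq Int_insert_right)
qed

text \<open>Some integral flow on \<open>T\<close> has boundary \<open>y\<close>, and its values can
  only be the cut sums. This is the unimodularity of the tree: cut sums are integral coordinates on
  the zero-sum lattice.\<close>

lemma boundary_cut:
  fixes y :: "'v::finite \<Rightarrow> int"
  assumes "spanning_tree T" "sum y UNIV = 0"
  shows "boundary T (\<lambda>a. sum y (tree_cut T a)) = y"
proof -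
  obtain z where z: "boundary T z = y"
    using spanning_flow assms spanning_tree_spanning by blast
  have "boundary T (\<lambda>a. sum y (tree_cut T a)) v = boundary T z v" for v
    unfolding boundary_def
    by (intro sum.cong refl) (simp only: sum_boundary_cut [OF assms(1), of _ z, unfolded z])
  with z show ?thesis by auto
qed

text \<open>The coefficients describe the path in \<open>T\<close> from the tail of \<open>a\<close>
  to its head, with sign -1 where an arc is traversed backwards.\<close>

lemma boundary_crossing_cut:
  fixes T :: "('v::finite \<times> 'v) set"
  assumes "spanning_tree T"
  shows "boundary T (\<lambda>b. crossing a (tree_cut T b)) v = crossing a {v}"
proof -
  have "sum (\<lambda>v. crossing a {v}) UNIV = 0"
    unfolding sum_crossing by (simp add: crossing_def)
  from boundary_cut [OF assms this] show ?thesis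
    unfolding sum_crossing by (rule fun_cong)
qed

text \<open>In a spanning subset of least cardinality, deleting \<open>a\<close> leaves some proper
  set uncrossed. That set was crossed by \<open>a\<close> alone, so it or its complement is the
  fundamental cut.\<close>

lemma spanning_contains_tree:
  assumes "finite T" "spanning T"
  shows "\<exists>T'\<subseteq>T. spanning_tree T'"
proof -
  obtain T' where T': "T' \<subseteq> T" "spanning T'"
      and min: "\<And>U. U \<subseteq> T \<Longrightarrow> spanning U \<Longrightarrow> card T' \<le> card U"
    using ex_has_least_nat [of "\<lambda>U. U \<subseteq> T \<and> spanning U" T card] assms by auto
  have "\<exists>S. is_cut T' a S" if "a \<in> T'" for a
  proof -
    have "finite T'"
      using T' assms finite_subset by blast
    then have "\<not> spanning (T' - {a})"
      using min [of "T' - {a}"] T'(1) that card_Diff1_less [of T' a] by (meson Diff_subset leD subset_trans)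
    then obtain S where S: "S \<noteq> {}" "S \<noteq> UNIV" "\<And>b. b \<in> T' \<Longrightarrow> b \<noteq> a \<Longrightarrow> crossing b S = 0"
      unfolding spanning_def by auto
    then have "crossing a S \<noteq> 0"
      using T' unfolding spanning_def by metis
    then consider "crossing a S = 1" | "crossing a (- S) = 1"
      unfolding crossing_Compl using abs_crossing_le [of a S] by linarith
    then show ?thesis
    proof cases
      case 1
      then show ?thesis using S(3) by (auto simp: is_cut_def intro!: exI [of _ S])
    next
      case 2
      then show ?thesis
        using S(3) by (auto simp: is_cut_def crossing_Compl intro!: exI [of _ "- S"])
    qed
  qed
  then show ?thesis
    using T' unfolding spanning_tree_def by blast
qed

subsection \<open>Optimal spanning trees for generic costs\<close>

text \<open>The term with the least exponent has strictly the lowest 2-adic valuation, and that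
  exponent is below \<open>N\<close>.\<close>

lemma not_dvd_signed_power_sum:
  fixes s :: "'a \<Rightarrow> int"
  assumes "finite B" "B \<noteq> {}" "inj_on i B" "\<And>b. b \<in> B \<Longrightarrow> odd (s b)" "\<And>b. b \<in> B \<Longrightarrow> i b < N"
  shows "\<not> 2 ^ N dvd (\<Sum>b\<in>B. s b * 2 ^ i b)"
proof
  assume dvd: "2 ^ N dvd (\<Sum>b\<in>B. s b * 2 ^ i b)"
  obtain b0 where b0: "b0 \<in> B" and min: "\<And>b. b \<in> B \<Longrightarrow> i b0 \<le> i b"
    using ex_min_if_finite [of "i ` B"] assms(1,2) by (fastforce simp: not_less)
  have rest: "2 ^ Suc (i b0) dvd (\<Sum>b\<in>B - {b0}. s b * 2 ^ i b)"
  proof (intro dvd_sum dvd_mult le_imp_power_dvd)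
    fix b assume "b \<in> B - {b0}"
    with min [of b] b0 assms(3) show "Suc (i b0) \<le> i b"
      by (metis DiffE insertCI inj_onD le_neq_implies_less Suc_leI)
  qed
  have "(2::int) ^ Suc (i b0) dvd 2 ^ N"
    using assms(5) [OF b0] by (intro le_imp_power_dvd) simp
  then have "2 ^ Suc (i b0) dvd (\<Sum>b\<in>B. s b * 2 ^ i b)"
    using dvd by (rule dvd_trans)
  also have "(\<Sum>b\<in>B. s b * 2 ^ i b) = s b0 * 2 ^ i b0 + (\<Sum>b\<in>B - {b0}. s b * 2 ^ i b)"
    using assms(1) b0 by (rule sum.remove)
  finally have "2 ^ Suc (i b0) dvd s b0 * 2 ^ i b0"
    unfolding dvd_add_left_iff [OF rest] .
  then have "2 dvd s b0" by simp
  with assms(4) [OF b0] show False by blast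
qed

text \<open>The weights \<open>w\<close> will be the signs of tree paths. \<open>generic\<close>
  excludes ties between an arc and the path replacing it, which gives uniqueness.
  \<open>nearly_uniform\<close> says that dual feasibility for \<open>c\<close> implies dual
  feasibility for unit costs, so that the cones of optimal trees fit the polytope.\<close>

locale network =
  fixes A :: "('v::finite \<times> 'v) set" and c :: "'v \<times> 'v \<Rightarrow> int"
  assumes sym: "(u, v) \<in> A \<Longrightarrow> (v, u) \<in> A"
    and spanning: "spanning A"
    and cost_pos: "a \<in> A \<Longrightarrow> 0 < c a"
    and generic: "\<lbrakk>T \<subseteq> A; a \<in> A - T; \<And>b. \<bar>w b\<bar> \<le> 1\<rbrakk> \<Longrightarrow> (\<Sum>b\<in>T. c b * w b) \<noteq> c a"
    and nearly_uniform: "\<lbrakk>T \<subseteq> A; a \<in> A; \<And>b. \<bar>w b\<bar> \<le> 1; (\<Sum>b\<in>T. c b * w b) \<le> c a\<rbrakk>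
      \<Longrightarrow> (\<Sum>b\<in>T. w b) \<le> 1"

lemma ex_network:
  fixes A :: "('v::finite \<times> 'v) set"
  assumes "\<And>u v. (u, v) \<in> A \<Longrightarrow> (v, u) \<in> A" "spanning A"
  shows "\<exists>c. network A c"
proof -
  obtain i where i: "bij_betw i A {0..<card A}"
    using ex_bij_betw_finite_nat [of A] by auto
  define N where "N = card A"
  \<comment> \<open>The distinct powers of 2 exclude relations with coefficients in \<open>{-1, 0, 1}\<close>; the large constant
    makes comparing costs first of all a comparison of coefficient sums.\<close>
  define c where "c a = 2 ^ (N + 2) + (2::int) ^ i a" for a
  have iN: "i a < N" if "a \<in> A" for a
    using bij_betwE [OF i] that by (auto simp: N_def)
  have inj: "inj_on i A"
    using i by (rule bij_betw_imp_inj_on)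
  have "network A c"
  proof
    fix a show "0 < c a" by (simp add: c_def add_pos_pos)
  next
    fix T a and w :: "'v \<times> 'v \<Rightarrow> int"
    assume T: "T \<subseteq> A" and a: "a \<in> A - T" and w: "\<And>b. \<bar>w b\<bar> \<le> 1"
    \<comment> \<open>Moving \<open>c a\<close> to the other side gives a relation on
      \<open>B\<close> whose coefficients are all 1 or -1, hence odd.\<close>
    define B where "B = insert a {b \<in> T. w b \<noteq> 0}"
    define s where "s = w(a := -1)"
    have B: "B \<subseteq> A" using T a by (auto simp: B_def)
    have sum_B: "(\<Sum>b\<in>B. s b * f b) = (\<Sum>b\<in>T. f b * w b) - f a" for f
    proof -
      have "(\<Sum>b\<in>B. s b * f b) = (\<Sum>b\<in>{b \<in> T. w b \<noteq> 0}. s b * f b) - f a"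
        using a by (simp add: B_def s_def)
      also have "(\<Sum>b\<in>{b \<in> T. w b \<noteq> 0}. s b * f b) = (\<Sum>b\<in>T. f b * w b)"
        using a by (intro sum.mono_neutral_cong_left) (auto simp: s_def)
      finally show ?thesis .
    qed
    have "\<not> 2 ^ N dvd (\<Sum>b\<in>B. s b * 2 ^ i b)"
    proof (rule not_dvd_signed_power_sum)
      show "inj_on i B" by (rule inj_on_subset [OF inj B])
      show "i b < N" if "b \<in> B" for b using that B iN by blast
      show "odd (s b)" if "b \<in> B" for b
      proof (cases "b = a")
        case False
        with that have "w b \<noteq> 0" by (auto simp: B_def)
        with w [of b] have "w b = 1 \<or> w b = -1" by linarith
        with False show ?thesis by (auto simp: s_def)
      qed (simp add: s_def)
    qed (auto simp: B_def)
    \<comment> \<open>The uniform part of \<open>c\<close> is a multiple of \<open>2 ^ N\<close>, so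
      a vanishing relation among the costs would make \<open>2 ^ N\<close> divide the signed sum of
      powers.\<close>
    moreover have "(\<Sum>b\<in>B. s b * 2 ^ i b) = (\<Sum>b\<in>B. s b * c b) - 2 ^ N * (4 * (\<Sum>b\<in>B. s b))"
      by (simp add: c_def distrib_left sum.distrib sum_distrib_left sum_distrib_right power_add
          mult_ac)
    ultimately have "(\<Sum>b\<in>B. s b * c b) \<noteq> 0"
      by auto
    then show "(\<Sum>b\<in>T. c b * w b) \<noteq> c a"
      by (simp add: sum_B)
  next
    fix T a and w :: "'v \<times> 'v \<Rightarrow> int"
    assume T: "T \<subseteq> A" and a: "a \<in> A" and w: "\<And>b. \<bar>w b\<bar> \<le> 1"
      and le: "(\<Sum>b\<in>T. c b * w b) \<le> c a"
    have "- (\<Sum>b\<in>T. 2 ^ i b * w b) \<le> (\<Sum>b\<in>T. 2 ^ i b)"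
      unfolding sum_negf [symmetric]
    proof (intro sum_mono)
      fix b assume "b \<in> T"
      have "- w b \<le> 1" using w [of b] by linarith
      from mult_left_mono [OF this, of "2 ^ i b"] show "- (2 ^ i b * w b) \<le> 2 ^ i b" by simp
    qed
    also have "\<dots> \<le> (\<Sum>b\<in>A. 2 ^ i b)"
      using T by (intro sum_mono2) auto
    also have "\<dots> = (\<Sum>j<N. 2 ^ j)"
      using sum.reindex_bij_betw [OF i, of "\<lambda>j. 2 ^ j :: int"] by (simp add: N_def lessThan_atLeast0)
    also have "\<dots> = 2 ^ N - 1"
      by (induction N) auto
    finally have 1: "- (\<Sum>b\<in>T. 2 ^ i b * w b) < 2 ^ N" by simp
    have 2: "(2::int) ^ i a \<le> 2 ^ N"
      using iN [OF a] by (intro power_increasing) auto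
    have "(\<Sum>b\<in>T. c b * w b) = 4 * 2 ^ N * (\<Sum>b\<in>T. w b) + (\<Sum>b\<in>T. 2 ^ i b * w b)"
      by (simp add: c_def distrib_right sum.distrib sum_distrib_left power_add)
    moreover have "c a = 4 * 2 ^ N + 2 ^ i a"
      by (simp add: c_def power_add)
    \<comment> \<open>The uniform part of \<open>c a\<close> contributes 4 units of
      \<open>2 ^ N\<close>, and the two perturbations at most one each. Four times an integer is
      below 6 only if that integer is at most 1.\<close>
    ultimately have "2 ^ N * (4 * (\<Sum>b\<in>T. w b)) < (2::int) ^ N * 6"
      using le 1 2 by linarith
    then show "(\<Sum>b\<in>T. w b) \<le> 1"
      by (subst (asm) mult_less_cancel_left_pos) auto
  qed (use assms in auto)
  then show ?thesis by blast
qed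

context network
begin

text \<open>Dual feasibility: replacing the arc \<open>a\<close> by the path in \<open>T\<close> with the same ends does not cost more.\<close>

definition optimal_tree :: "('v \<times> 'v) set \<Rightarrow> bool" where
  "optimal_tree T \<longleftrightarrow> T \<subseteq> A \<and> spanning_tree T \<and>
     (\<forall>a\<in>A. (\<Sum>b\<in>T. c b * crossing a (tree_cut T b)) \<le> c a)"

lemma nonneg_flow:
  fixes y :: "'v \<Rightarrow> int"
  assumes "sum y UNIV = 0"
  shows "\<exists>z. (\<forall>a. 0 \<le> z a) \<and> boundary A z = y"
proof -
  obtain w where w: "boundary A w = y"
    using spanning_flow [OF spanning assms] by blast
  \<comment> \<open>Negative flow on an arc is replaced by positive flow on the reversed arc, which
    \<open>sym\<close> provides.\<close>
  define z where "z a = max (w a) 0 + max (- w (prod.swap a)) 0" for a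
  have "boundary A z v = boundary A w v" for v
  proof -
    have "(\<Sum>a\<in>A. max (- w (prod.swap a)) 0 * crossing a {v})
        = (\<Sum>a\<in>A. - max (- w a) 0 * crossing a {v})"
      by (rule sum.reindex_bij_witness [of _ prod.swap prod.swap])
        (auto simp: sym crossing_def algebra_simps)
    then have "boundary A z v = (\<Sum>a\<in>A. (max (w a) 0 - max (- w a) 0) * crossing a {v})"
      by (simp add: boundary_def z_def distrib_right left_diff_distrib sum.distrib sum_subtractf sum_negf)
    also have "\<dots> = boundary A w v"
      unfolding boundary_def by (intro sum.cong) auto
    finally show ?thesis .
  qed
  with w have "boundary A z = y" by auto
  moreover have "0 \<le> z a" for a by (simp add: z_def)
  ultimately show ?thesis by blast
qed

text \<open>Take an integral flow of least cost. Its support is spanning because every proper set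
  has nonzero net inflow, so it contains a spanning tree \<open>T\<close>. Pushing a unit round
  fundamental circulations shows that \<open>T\<close> is dual feasible and that the support is no
  larger than \<open>T\<close>.\<close>

lemma optimal_tree_exists:
  fixes y :: "'v \<Rightarrow> int"
  assumes y: "sum y UNIV = 0" and y_nz: "\<And>S. S \<noteq> {} \<Longrightarrow> S \<noteq> UNIV \<Longrightarrow> sum y S \<noteq> 0"
  shows "\<exists>T. optimal_tree T \<and> (\<forall>a\<in>T. 0 < sum y (tree_cut T a))"
proof -
  define cost where "cost z = (\<Sum>a\<in>A. c a * z a)" for z
  define feasible where "feasible z \<longleftrightarrow> (\<forall>a. 0 \<le> z a) \<and> boundary A z = y" for z
  \<comment> \<open>The minimum is taken over natural numbers; costs of feasible flows are
    nonnegative, so \<open>nat\<close> changes nothing on them.\<close>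
  obtain z where z: "feasible z" and min: "\<And>z'. feasible z' \<Longrightarrow> nat (cost z) \<le> nat (cost z')"
    using ex_has_least_nat [of feasible _ "\<lambda>z. nat (cost z)"] nonneg_flow [OF y]
    unfolding feasible_def by metis
  have min: "cost z \<le> cost z'" if "feasible z'" for z'
  proof -
    have "0 \<le> cost z'"
      unfolding cost_def
    proof (intro sum_nonneg mult_nonneg_nonneg)
      show "0 \<le> c a" if "a \<in> A" for a using cost_pos [OF that] by simp
      show "0 \<le> z' a" for a using \<open>feasible z'\<close> unfolding feasible_def by blast
    qed
    with min [OF that] show ?thesis by simp
  qed
  have z0: "0 \<le> z a" for a
    using z unfolding feasible_def by blast
  have bz: "boundary A z = y"
    using z unfolding feasible_def by blast
  define T0 where "T0 = {a \<in> A. 0 < z a}"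
  have "spanning T0"
    unfolding spanning_def
  proof (intro allI impI, elim conjE)
    fix S :: "'v set" assume "S \<noteq> {}" "S \<noteq> UNIV"
    then have "(\<Sum>a\<in>A. z a * crossing a S) \<noteq> 0"
      using y_nz unfolding sum_boundary [symmetric] bz by blast
    then obtain a where "a \<in> A" "z a * crossing a S \<noteq> 0"
      by (meson sum.neutral)
    then show "\<exists>a\<in>T0. crossing a S \<noteq> 0"
      using z0 [of a] unfolding T0_def by (intro bexI [of _ a]) auto
  qed
  then obtain T where T: "T \<subseteq> T0" "spanning_tree T"
    using spanning_contains_tree [of T0] by auto
  then have TA: "T \<subseteq> A" by (auto simp: T0_def)
  have zT: "1 \<le> z a" if "a \<in> T" for a using T that by (auto simp: T0_def)
  \<comment> \<open>the fundamental circulation of \<open>a\<close> with respect to \<open>T\<close>\<close>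
  define circ where "circ a b = of_bool (b = a) - of_bool (b \<in> T) * crossing a (tree_cut T b)" for a b
  have boundary_T: "boundary A (\<lambda>b. of_bool (b \<in> T) * w b) v = boundary T w v" for w v
    unfolding boundary_def using TA by (intro sum.mono_neutral_cong_right) auto
  have boundary_circ: "boundary A (circ a) v = 0" if "a \<in> A" for a v
  proof -
    have "boundary A (circ a) v = boundary A (\<lambda>b. of_bool (b = a) * 1) v
        - boundary A (\<lambda>b. of_bool (b \<in> T) * crossing a (tree_cut T b)) v"
      unfolding circ_def by (simp only: boundary_diff mult_1_right)
    also have "\<dots> = 0"
      unfolding boundary_T boundary_single [OF that finite] boundary_crossing_cut [OF T(2)] by simp
    finally show ?thesis .
  qed
  have cost_circ: "cost (circ a) = c a - (\<Sum>b\<in>T. c b * crossing a (tree_cut T b))" if "a \<in> A" for a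
  proof -
    have "cost (circ a) = (\<Sum>b\<in>A. c b * of_bool (b = a))
        - (\<Sum>b\<in>A. of_bool (b \<in> T) * (c b * crossing a (tree_cut T b)))"
      by (simp only: cost_def circ_def right_diff_distrib sum_subtractf mult.left_commute)
    also have "(\<Sum>b\<in>A. c b * of_bool (b = a)) = c a"
      using that by (simp add: Int_insert_right)
    also have "(\<Sum>b\<in>A. of_bool (b \<in> T) * (c b * crossing a (tree_cut T b)))
        = (\<Sum>b\<in>T. c b * crossing a (tree_cut T b))"
      using TA by (intro sum.mono_neutral_cong_right) auto
    finally show ?thesis .
  qed
  have "0 \<le> cost (circ a)" if "a \<in> A" for a
  proof -
    \<comment> \<open>The circulation is never below -1, and is negative only on arcs of
      \<open>T\<close>, where integrality gives \<open>z\<close> at least 1.\<close>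
    have "feasible (\<lambda>b. z b + circ a b)"
      unfolding feasible_def
    proof (intro conjI allI ext)
      fix b show "0 \<le> z b + circ a b"
        using zT [of b] z0 [of b] abs_crossing_le [of a "tree_cut T b"]
        by (cases "b \<in> T"; cases "b = a") (simp_all add: circ_def)
    qed (simp add: boundary_add bz boundary_circ that)
    from min [OF this] show ?thesis
      by (simp add: cost_def distrib_left sum.distrib)
  qed
  then have dual: "(\<Sum>b\<in>T. c b * crossing a (tree_cut T b)) \<le> c a" if "a \<in> A" for a
    using that cost_circ by fastforce
  then have "optimal_tree T"
    using T TA by (auto simp: optimal_tree_def)
  moreover have "T0 = T"
  proof (rule ccontr)
    assume "T0 \<noteq> T"
    with T obtain a where a: "a \<in> A" "a \<notin> T" "0 < z a" by (auto simp: T0_def)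
    \<comment> \<open>A positive \<open>z a\<close> also permits the push in the opposite direction.
      The cost of the circulation is then 0, a tie that \<open>generic\<close> forbids.\<close>
    have "feasible (\<lambda>b. z b - circ a b)"
      unfolding feasible_def
    proof (intro conjI allI ext)
      fix b show "0 \<le> z b - circ a b"
        using zT [of b] z0 [of b] abs_crossing_le [of a "tree_cut T b"] a
        by (cases "b \<in> T"; cases "b = a") (auto simp add: circ_def)
    qed (simp add: boundary_diff bz boundary_circ a)
    from min [OF this] have "cost (circ a) \<le> 0"
      by (simp add: cost_def right_diff_distrib sum_subtractf)
    with dual [OF a(1)] cost_circ [OF a(1)]
    have "(\<Sum>b\<in>T. c b * crossing a (tree_cut T b)) = c a" by simp
    then show False
      using generic [of T a "\<lambda>b. crossing a (tree_cut T b)"] a TA by (auto simp: abs_crossing_le)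
  qed
  moreover have "sum y (tree_cut T a) = z a" if "a \<in> T" for a
  proof -
    have "z a = 0" if "a \<in> A - T" for a
      using that z0 [of a] \<open>T0 = T\<close> by (auto simp: T0_def)
    then have "boundary A z v = boundary T z v" for v
      unfolding boundary_def using TA by (intro sum.mono_neutral_right) auto
    then have "boundary T z = y" using bz by auto
    then show ?thesis
      using sum_boundary_cut [OF T(2) that, of z] by simp
  qed
  then have "\<forall>a\<in>T. 0 < sum y (tree_cut T a)"
    using zT by fastforce
  ultimately show ?thesis by blast
qed

text \<open>Weak duality and complementary slackness of linear programming. Let the price of an arc
  be the cost of the path in \<open>T\<close> that replaces it. At these prices the flow on
  \<open>U\<close> costs exactly as much as the flow on \<open>T\<close>, and prices never exceed
  costs. Equality forces price and cost to agree on \<open>U\<close>, where the flow is positive,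
  and \<open>generic\<close> then puts \<open>U\<close> inside \<open>T\<close>.\<close>

lemma optimal_tree_duality:
  fixes y :: "'v \<Rightarrow> int"
  assumes T: "optimal_tree T" "\<And>a. a \<in> T \<Longrightarrow> 0 < sum y (tree_cut T a)"
    and U: "optimal_tree U" "\<And>a. a \<in> U \<Longrightarrow> 0 < sum y (tree_cut U a)"
    and y: "sum y UNIV = 0"
  shows "(\<Sum>a\<in>T. c a * sum y (tree_cut T a)) \<le> (\<Sum>a\<in>U. c a * sum y (tree_cut U a))" (is "?t \<le> ?u")
    and "(\<Sum>a\<in>T. c a * sum y (tree_cut T a)) = (\<Sum>a\<in>U. c a * sum y (tree_cut U a)) \<Longrightarrow> U \<subseteq> T"
proof -
  define price where "price a = (\<Sum>b\<in>T. c b * crossing a (tree_cut T b))" for a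
  have t: "?t = (\<Sum>a\<in>U. price a * sum y (tree_cut U a))"
  proof -
    have "boundary U (\<lambda>a. sum y (tree_cut U a)) = y"
      using boundary_cut [OF _ y] U(1) by (simp add: optimal_tree_def)
    \<comment> \<open>The price of a flow depends only on its boundary, which is \<open>y\<close>
      for both trees.\<close>
    then have expand: "(\<Sum>a\<in>U. sum y (tree_cut U a) * crossing a S) = sum y S" for S
      using sum_boundary [of U "\<lambda>a. sum y (tree_cut U a)" S] by simp
    have "?t = (\<Sum>b\<in>T. \<Sum>a\<in>U. c b * (sum y (tree_cut U a) * crossing a (tree_cut T b)))"
      by (simp only: sum_distrib_left [symmetric] expand)
    also have "\<dots> = (\<Sum>a\<in>U. \<Sum>b\<in>T. c b * (sum y (tree_cut U a) * crossing a (tree_cut T b)))"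
      by (rule sum.swap)
    also have "\<dots> = (\<Sum>a\<in>U. price a * sum y (tree_cut U a))"
      unfolding price_def
      by (intro sum.cong refl, subst sum_distrib_right, intro sum.cong refl) (simp only: mult_ac)
    finally show ?thesis .
  qed
  have le: "price a * sum y (tree_cut U a) \<le> c a * sum y (tree_cut U a)" if "a \<in> U" for a
    using T(1) U that by (intro mult_right_mono) (auto simp: optimal_tree_def price_def less_imp_le)
  show "?t \<le> ?u"
    unfolding t using le by (rule sum_mono)
  assume "?t = ?u"
  then have "0 = (\<Sum>a\<in>U. c a * sum y (tree_cut U a) - price a * sum y (tree_cut U a))"
    using t by (simp add: sum_subtractf)
  then have eq: "price a * sum y (tree_cut U a) = c a * sum y (tree_cut U a)" if "a \<in> U" for a
    using that le sum_nonneg_eq_0_iff [of U "\<lambda>a. c a * sum y (tree_cut U a) - price a * sum y (tree_cut U a)"]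
    by fastforce
  have "price a = c a" if "a \<in> U" for a
    using eq [OF that] U(2) [OF that] by simp
  then show "U \<subseteq> T"
    using generic [of T a "\<lambda>b. crossing a (tree_cut T b)" for a] T(1) U(1) abs_crossing_le
    unfolding optimal_tree_def price_def by (meson DiffI subset_eq)
qed

lemma optimal_tree_ex1:
  fixes y :: "'v \<Rightarrow> int"
  assumes "sum y UNIV = 0" and "\<And>S. S \<noteq> {} \<Longrightarrow> S \<noteq> UNIV \<Longrightarrow> sum y S \<noteq> 0"
  shows "\<exists>!T. optimal_tree T \<and> (\<forall>a\<in>T. 0 < sum y (tree_cut T a))"
proof (rule ex_ex1I)
  fix T U
  assume T: "optimal_tree T \<and> (\<forall>a\<in>T. 0 < sum y (tree_cut T a))"
    and U: "optimal_tree U \<and> (\<forall>a\<in>U. 0 < sum y (tree_cut U a))"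
  have eq: "(\<Sum>a\<in>T. c a * sum y (tree_cut T a)) = (\<Sum>a\<in>U. c a * sum y (tree_cut U a))"
    using optimal_tree_duality(1) [OF _ _ _ _ assms(1)] T U by (meson order_antisym)
  then show "T = U"
    using optimal_tree_duality(2) [OF _ _ _ _ assms(1)] T U
    by (intro subset_antisym) (metis (no_types, lifting))+
qed (use optimal_tree_exists assms in blast)

end

subsection \<open>Root polytopes\<close>

definition arc_vector :: "'v::finite \<times> 'v \<Rightarrow> real ^ 'v" where
  "arc_vector a = axis (snd a) 1 - axis (fst a) 1"

definition real_vec :: "('v::finite \<Rightarrow> int) \<Rightarrow> real ^ 'v" where
  "real_vec x = (\<chi> v. real_of_int (x v))"

definition root_polytope :: "('v::finite \<times> 'v) set \<Rightarrow> (real ^ 'v) set" where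
  "root_polytope A = convex hull (arc_vector ` A)"

lemma real_vec_nth [simp]: "real_vec x $ v = real_of_int (x v)"
  by (simp add: real_vec_def)

lemma inj_real_vec: "inj real_vec"
  by (auto simp: inj_def vec_eq_iff)

lemma arc_vector_eq: "arc_vector a = real_vec (\<lambda>v. crossing a {v})"
  by (auto simp: arc_vector_def crossing_def vec_eq_iff axis_def)

lemma sum_arc_vector: "(\<Sum>v\<in>S. arc_vector a $ v) = real_of_int (crossing a S)"
  by (simp add: arc_vector_eq sum_crossing flip: of_int_sum)

lemma real_vec_boundary: "real_vec (boundary T z) = (\<Sum>a\<in>T. real_of_int (z a) *\<^sub>R arc_vector a)"
  by (simp add: vec_eq_iff boundary_def arc_vector_eq)

lemma subspace_zero_sum: "subspace {p :: real ^ 'v::finite. (\<Sum>v\<in>S. p $ v) = 0}"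
  by (simp add: subspace_def sum.distrib flip: sum_distrib_left)

lemma zero_sum_eq_hyperplane:
  "{p :: real ^ 'v::finite. (\<Sum>v\<in>UNIV. p $ v) = 0} = {p. (\<chi> v. 1) \<bullet> p = 0}"
  by (simp add: inner_vec_def)

lemma dim_zero_sum: "dim {p :: real ^ 'v::finite. (\<Sum>v\<in>UNIV. p $ v) = 0} = CARD('v) - 1"
proof -
  have "(\<chi> v. 1) \<noteq> (0 :: real ^ 'v)"
    by (simp add: vec_eq_iff)
  then show ?thesis
    unfolding zero_sum_eq_hyperplane by (simp add: dim_hyperplane)
qed

text \<open>Connectedness puts every difference of two unit vectors into the span, and the
  differences from a fixed \<open>u\<close> generate the zero-sum hyperplane.\<close>

lemma span_arc_vectors:
  fixes T :: "('v::finite \<times> 'v) set"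
  assumes "spanning T"
  shows "span (arc_vector ` T) = {p. (\<Sum>v\<in>UNIV. p $ v) = 0}"
proof
  have "arc_vector ` T \<subseteq> {p. (\<Sum>v\<in>UNIV. p $ v) = 0}"
    by (auto simp: sum_arc_vector crossing_def)
  then show "span (arc_vector ` T) \<subseteq> {p. (\<Sum>v\<in>UNIV. p $ v) = 0}"
    using subspace_zero_sum by (rule span_minimal)
  fix u :: 'v
  have "{v. axis v 1 - axis u 1 \<in> span (arc_vector ` T)} = UNIV"
  proof (rule spanning_closed_UNIV [OF assms])
    show "u \<in> {v. axis v 1 - axis u 1 \<in> span (arc_vector ` T)}"
      by (simp add: span_zero)
    fix a assume "a \<in> T"
    then have "arc_vector a \<in> span (arc_vector ` T)"
      by (intro span_base imageI)
    moreover have "axis (snd a) 1 - axis u 1 = arc_vector a + (axis (fst a) 1 - axis u 1)"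
      by (simp add: arc_vector_def)
    ultimately show "fst a \<in> {v. axis v 1 - axis u 1 \<in> span (arc_vector ` T)}
        \<longleftrightarrow> snd a \<in> {v. axis v 1 - axis u 1 \<in> span (arc_vector ` T)}"
      unfolding mem_Collect_eq by (metis span_add_eq)
  qed
  then have in_span: "axis v 1 - axis u 1 \<in> span (arc_vector ` T)" for v
    by blast
  show "{p. (\<Sum>v\<in>UNIV. p $ v) = 0} \<subseteq> span (arc_vector ` T)"
  proof
    fix p :: "real ^ 'v" assume "p \<in> {p. (\<Sum>v\<in>UNIV. p $ v) = 0}"
    then have p: "(\<Sum>v\<in>UNIV. p $ v) = 0" by simp
    have "p = (\<Sum>v\<in>UNIV. p $ v *\<^sub>R (axis v 1 - axis u 1))"
    proof (subst vec_eq_iff, intro allI)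
      fix w
      have "(\<Sum>v\<in>UNIV. p $ v *\<^sub>R (axis v 1 - axis u 1)) $ w
          = (\<Sum>v\<in>UNIV. p $ v * axis v 1 $ w) - (\<Sum>v\<in>UNIV. p $ v) * axis u 1 $ w"
        by (simp add: right_diff_distrib sum_subtractf sum_distrib_right)
      also have "\<dots> = p $ w"
        unfolding p by (simp add: axis_def if_distrib cong: if_cong)
      finally show "p $ w = (\<Sum>v\<in>UNIV. p $ v *\<^sub>R (axis v 1 - axis u 1)) $ w" ..
    qed
    also have "\<dots> \<in> span (arc_vector ` T)"
      by (intro span_sum span_scale in_span)
    finally show "p \<in> span (arc_vector ` T)" .
  qed
qed

text \<open>The sums over the fundamental cuts are functionals dual to the arc vectors, which are
  therefore a basis of the zero-sum hyperplane.\<close>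

lemma card_spanning_tree:
  fixes T :: "('v::finite \<times> 'v) set"
  assumes T: "spanning_tree T"
  shows "card T = CARD('v) - 1"
proof -
  have cut: "(\<Sum>v\<in>tree_cut T a. arc_vector b $ v) = of_bool (b = a)" if "a \<in> T" "b \<in> T" for a b
    using crossing_cut [OF T that] by (simp add: sum_arc_vector)
  have inj: "inj_on arc_vector T"
  proof (rule inj_onI)
    fix a b assume a: "a \<in> T" and b: "b \<in> T" and eq: "arc_vector a = arc_vector b"
    have "of_bool (b = a) = (of_bool (a = a) :: real)"
      unfolding cut [OF a a, symmetric] cut [OF a b, symmetric] eq ..
    then show "a = b" by (simp split: if_splits)
  qed
  have "independent (arc_vector ` T)"
    unfolding dependent_def
  proof safe
    fix a b assume a: "(a, b) \<in> T"
      and span: "arc_vector (a, b) \<in> span (arc_vector ` T - {arc_vector (a, b)})"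
    have "arc_vector ` T - {arc_vector (a, b)} \<subseteq> {p. (\<Sum>v\<in>tree_cut T (a, b). p $ v) = 0}"
      using cut [OF a] by auto
    then have "span (arc_vector ` T - {arc_vector (a, b)}) \<subseteq> {p. (\<Sum>v\<in>tree_cut T (a, b). p $ v) = 0}"
      using subspace_zero_sum by (rule span_minimal)
    then show False
      using span cut [OF a a] by auto
  qed
  then have "dim (span (arc_vector ` T)) = card (arc_vector ` T)"
    by (simp add: dim_eq_card_independent)
  then show ?thesis
    unfolding span_arc_vectors [OF spanning_tree_spanning [OF T]] dim_zero_sum card_image [OF inj] ..
qed

text \<open>The missing weight is given to the point 0.\<close>

lemma convex_sum_le_one:
  fixes S :: "'a::real_vector set"
  assumes "finite I" "convex S" "0 \<in> S" "\<And>i. i \<in> I \<Longrightarrow> 0 \<le> u i" "sum u I \<le> 1"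
    and "\<And>i. i \<in> I \<Longrightarrow> f i \<in> S"
  shows "(\<Sum>i\<in>I. u i *\<^sub>R f i) \<in> S"
proof (cases "sum u I = 0")
  case True
  then have "u i = 0" if "i \<in> I" for i
    using assms(1,4) that by (simp add: sum_nonneg_eq_0_iff)
  with \<open>0 \<in> S\<close> show ?thesis by simp
next
  case False
  moreover have "0 \<le> sum u I" using assms(4) by (rule sum_nonneg)
  ultimately have pos: "0 < sum u I" by simp
  have "(\<Sum>i\<in>I. (u i / sum u I) *\<^sub>R f i) \<in> S"
    using assms pos by (intro convex_sum) (auto simp flip: sum_divide_distrib)
  then have "sum u I *\<^sub>R (\<Sum>i\<in>I. (u i / sum u I) *\<^sub>R f i) + (1 - sum u I) *\<^sub>R 0 \<in> S"
    using assms pos by (intro convexD) auto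
  with pos show ?thesis
    by (simp add: scaleR_sum_right)
qed

text \<open>A linear functional is bounded on a convex hull by its bound on the generators. The
  functionals are combinations of sums over vertex sets, the shape that tree cuts have.\<close>

lemma root_polytope_le:
  fixes A :: "('v::finite \<times> 'v) set"
  assumes "p \<in> root_polytope A" and "\<And>a. a \<in> A \<Longrightarrow> (\<Sum>b\<in>T. w b * (\<Sum>v\<in>S b. arc_vector a $ v)) \<le> k"
  shows "(\<Sum>b\<in>T. w b * (\<Sum>v\<in>S b. p $ v)) \<le> k"
proof -
  let ?f = "\<lambda>p. \<Sum>b\<in>T. w b * (\<Sum>v\<in>S b. p $ v)"
  have lin: "?f (\<alpha> *\<^sub>R p + \<beta> *\<^sub>R q) = \<alpha> * ?f p + \<beta> * ?f q" for \<alpha> \<beta> and p q :: "real ^ 'v"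
    by (simp add: sum.distrib distrib_left sum_distrib_left mult_ac)
  have "convex {p. ?f p \<le> k}"
    by (rule convexI) (simp only: mem_Collect_eq lin, rule convex_bound_le)
  then have "convex hull (arc_vector ` A) \<subseteq> {p. ?f p \<le> k}"
    using assms(2) by (intro hull_minimal) auto
  with assms(1) show ?thesis by (auto simp: root_polytope_def)
qed

text \<open>The coordinate sum and its negative are both at most 0 on arc vectors; the index set
  \<open>{()}\<close> makes each a one-term combination.\<close>

lemma root_polytope_zero_sum:
  assumes "p \<in> root_polytope A"
  shows "(\<Sum>v\<in>UNIV. p $ v) = 0"
  using root_polytope_le [OF assms, where T = "{()}" and w = "\<lambda>_. 1" and S = "\<lambda>_. UNIV" and k = 0]
    root_polytope_le [OF assms, where T = "{()}" and w = "\<lambda>_. - 1" and S = "\<lambda>_. UNIV" and k = 0]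
  by (simp add: sum_arc_vector crossing_def)

section \<open>The polytope of a network: dimension, half-open cones and dilates\<close>

context network
begin

lemma zero_in_root_polytope:
  assumes "A \<noteq> {}"
  shows "0 \<in> root_polytope A"
proof -
  obtain u v where "(u, v) \<in> A" using assms by auto
  then have "arc_vector (u, v) \<in> root_polytope A" "arc_vector (v, u) \<in> root_polytope A"
    using sym by (auto simp: root_polytope_def intro: hull_inc)
  then have "(1/2) *\<^sub>R arc_vector (u, v) + (1/2) *\<^sub>R arc_vector (v, u) \<in> root_polytope A"
    unfolding root_polytope_def by (intro convexD [OF convex_convex_hull]) auto
  then show ?thesis
    by (simp add: arc_vector_def flip: scaleR_add_right)
qed

lemma aff_dim_root_polytope:
  assumes "A \<noteq> {}"
  shows "aff_dim (root_polytope A) = int (CARD('v) - 1)"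
proof -
  have "0 \<in> affine hull (arc_vector ` A)"
    using zero_in_root_polytope [OF assms] convex_hull_subset_affine_hull
    unfolding root_polytope_def by blast
  then have "aff_dim (root_polytope A) = int (dim (span (arc_vector ` A)))"
    by (simp add: root_polytope_def aff_dim_convex_hull aff_dim_zero)
  then show ?thesis
    by (simp add: span_arc_vectors spanning dim_zero_sum)
qed

text \<open>A facet of the cone of \<open>T\<close> is removed, by the lower bound 1 instead of 0,
  exactly when the push moves points of that facet out of the cone. For \<open>\<sigma>\<close> true
  these are the cuts containing \<open>r\<close>, for \<open>\<sigma>\<close> false the
  others.\<close>

lemma half_open_ex1:
  fixes x :: "'v \<Rightarrow> int" and r :: 'v and \<sigma> :: bool
  assumes "sum x UNIV = 0"
  shows "\<exists>!T. optimal_tree T \<and> (\<forall>a\<in>T. of_bool ((r \<in> tree_cut T a) = \<sigma>) \<le> sum x (tree_cut T a))"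
proof -
  define n where "n = int CARD('v)"
  define s where "s = (if \<sigma> then 1 else - 1 :: int)"
  \<comment> \<open>\<open>x\<close> pushed away from or towards \<open>r\<close>, scaled by \<open>n\<close> to stay integral: modulo \<open>n\<close> the sum of
    \<open>y\<close> over a proper vertex set is plus or minus its cardinality, hence nonzero.\<close>
  define y where "y v = n * x v + s * (1 - n * of_bool (v = r))" for v
  have sum_y: "sum y S = n * sum x S + s * (int (card S) - n * of_bool (r \<in> S))" for S
  proof -
    have "(\<Sum>v\<in>S. of_bool (v = r)) = (of_bool (r \<in> S) :: int)"
      by (simp add: of_bool_def)
    then have "(\<Sum>v\<in>S. s * (1 - n * of_bool (v = r))) = s * (int (card S) - n * of_bool (r \<in> S))"
      by (simp add: sum_subtractf flip: sum_distrib_left)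
    then show ?thesis
      by (simp add: y_def sum.distrib sum_distrib_left)
  qed
  \<comment> \<open>An offset strictly between 0 and \<open>n\<close> leaves the sign to be decided
    by \<open>k\<close> alone.\<close>
  have pos: "0 < n * k + l \<longleftrightarrow> 0 \<le> k" "0 < n * k - l \<longleftrightarrow> 1 \<le> k" "n * k + l \<noteq> 0"
    if "0 < l" "l < n" for k l :: int
  proof -
    consider "k \<le> - 1" | "k = 0" | "1 \<le> k" by linarith
    then have "(0 < n * k + l \<longleftrightarrow> 0 \<le> k) \<and> (0 < n * k - l \<longleftrightarrow> 1 \<le> k) \<and> n * k + l \<noteq> 0"
    proof cases
      case 1
      then have "n * k \<le> n * (- 1)" using that by (intro mult_left_mono) auto
      with that 1 show ?thesis by (smt (verit))
    next
      case 3
      then have "n * 1 \<le> n * k" using that by (intro mult_left_mono) auto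
      with that 3 show ?thesis by (smt (verit))
    qed (use that in auto)
    then show "0 < n * k + l \<longleftrightarrow> 0 \<le> k" "0 < n * k - l \<longleftrightarrow> 1 \<le> k" "n * k + l \<noteq> 0" by auto
  qed
  have cut: "(0 < sum y S \<longleftrightarrow> of_bool ((r \<in> S) = \<sigma>) \<le> sum x S) \<and> sum y S \<noteq> 0"
    if S: "S \<noteq> {}" "S \<noteq> UNIV" for S
  proof -
    define l where "l = int (card S)"
    have "0 < l" using S by (simp add: l_def card_gt_0_iff)
    moreover have "l < n"
      unfolding l_def n_def using S by (simp add: psubset_card_mono psubset_eq)
    ultimately have l: "0 < l" "l < n" "0 < n - l" "n - l < n" by auto
    \<comment> \<open>The offset is the cardinality of \<open>S\<close> or of its complement, and
      the sign of \<open>s\<close> may be reversed; this accounts for the four instances.\<close>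
    show ?thesis
      using pos [OF l(1,2), of "sum x S"] pos [OF l(3,4), of "sum x S"] pos [OF l(3,4), of "- sum x S"]
        pos [OF l(1,2), of "- sum x S"]
      by (cases \<sigma>; cases "r \<in> S") (auto simp: sum_y s_def simp flip: l_def)
  qed
  have "sum y UNIV = 0"
    using assms by (simp add: sum_y n_def)
  then have "\<exists>!T. optimal_tree T \<and> (\<forall>a\<in>T. 0 < sum y (tree_cut T a))"
    using cut by (intro optimal_tree_ex1) auto
  moreover have "optimal_tree T \<and> (\<forall>a\<in>T. 0 < sum y (tree_cut T a)) \<longleftrightarrow>
      optimal_tree T \<and> (\<forall>a\<in>T. of_bool ((r \<in> tree_cut T a) = \<sigma>) \<le> sum x (tree_cut T a))" for T
  proof (cases "optimal_tree T")
    case True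
    then have "spanning_tree T" by (simp add: optimal_tree_def)
    with True show ?thesis
      using cut [of "tree_cut T a" for a] cut_nontrivial [of T] by simp
  qed simp
  ultimately show ?thesis by simp
qed

text \<open>The sum over all tree cuts is 1 on the arcs of \<open>T\<close> and, by
  \<open>nearly_uniform\<close>, at most 1 on every arc. So on the cone of \<open>T\<close> it is
  the gauge of the polytope; conversely the cut values divided by \<open>k\<close> are weights of a
  convex combination with 0.\<close>

lemma real_vec_in_dilate_iff:
  fixes x :: "'v \<Rightarrow> int"
  assumes "A \<noteq> {}" and T: "optimal_tree T" and x: "sum x UNIV = 0"
    and nonneg: "\<And>a. a \<in> T \<Longrightarrow> 0 \<le> sum x (tree_cut T a)"
  shows "real_vec x \<in> (\<lambda>p. real k *\<^sub>R p) ` root_polytope A \<longleftrightarrow>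
    (\<Sum>a\<in>T. sum x (tree_cut T a)) \<le> int k"
proof
  assume "real_vec x \<in> (\<lambda>p. real k *\<^sub>R p) ` root_polytope A"
  then obtain p where p: "p \<in> root_polytope A" and xp: "real_vec x = real k *\<^sub>R p" by blast
  have "(\<Sum>b\<in>T. 1 * (\<Sum>v\<in>tree_cut T b. p $ v)) \<le> 1"
  proof (rule root_polytope_le [OF p])
    fix a assume a: "a \<in> A"
    have "(\<Sum>b\<in>T. crossing a (tree_cut T b)) \<le> 1"
      using T a by (intro nearly_uniform [of T a]) (simp_all add: optimal_tree_def abs_crossing_le)
    then have "real_of_int (\<Sum>b\<in>T. crossing a (tree_cut T b)) \<le> 1" by linarith
    then show "(\<Sum>b\<in>T. 1 * (\<Sum>v\<in>tree_cut T b. arc_vector a $ v)) \<le> 1"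
      by (simp add: sum_arc_vector)
  qed
  then have "real k * (\<Sum>b\<in>T. \<Sum>v\<in>tree_cut T b. p $ v) \<le> real k * 1"
    by (intro mult_left_mono) auto
  also have "real k * (\<Sum>b\<in>T. \<Sum>v\<in>tree_cut T b. p $ v) = (\<Sum>b\<in>T. \<Sum>v\<in>tree_cut T b. real_vec x $ v)"
    unfolding xp by (simp add: sum_distrib_left)
  also have "\<dots> = real_of_int (\<Sum>a\<in>T. sum x (tree_cut T a))" by simp
  finally show "(\<Sum>a\<in>T. sum x (tree_cut T a)) \<le> int k" by linarith
next
  assume le: "(\<Sum>a\<in>T. sum x (tree_cut T a)) \<le> int k"
  have "x = boundary T (\<lambda>a. sum x (tree_cut T a))"
    using boundary_cut [OF _ x] T by (simp add: optimal_tree_def)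
  then have x_eq: "real_vec x = (\<Sum>a\<in>T. real_of_int (sum x (tree_cut T a)) *\<^sub>R arc_vector a)"
    using real_vec_boundary [of T "\<lambda>a. sum x (tree_cut T a)"] by simp
  show "real_vec x \<in> (\<lambda>p. real k *\<^sub>R p) ` root_polytope A"
  \<comment> \<open>Division by \<open>k\<close> is impossible here, but then all cut values vanish
    and the point is 0.\<close>
  proof (cases "k = 0")
    case True
    then have "sum x (tree_cut T a) = 0" if "a \<in> T" for a
      using le nonneg that sum_nonneg [of T "\<lambda>a. sum x (tree_cut T a)"]
        sum_nonneg_eq_0_iff [of T "\<lambda>a. sum x (tree_cut T a)"] by force
    then have "real_vec x = 0" unfolding x_eq by simp
    then show ?thesis
      using zero_in_root_polytope [OF assms(1)] True by auto
  next
    case False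
    have "(\<Sum>a\<in>T. (real_of_int (sum x (tree_cut T a)) / real k) *\<^sub>R arc_vector a) \<in> root_polytope A"
    proof (rule convex_sum_le_one)
      show "(\<Sum>a\<in>T. real_of_int (sum x (tree_cut T a)) / real k) \<le> 1"
        using le False by (simp flip: sum_divide_distrib of_int_sum)
      show "arc_vector a \<in> root_polytope A" if "a \<in> T" for a
        using that T by (auto simp: optimal_tree_def root_polytope_def intro: hull_inc)
      show "0 \<le> real_of_int (sum x (tree_cut T a)) / real k" if "a \<in> T" for a
        using nonneg [OF that] by (intro divide_nonneg_nonneg) linarith+
    qed (use zero_in_root_polytope [OF assms(1)] in \<open>auto simp: root_polytope_def\<close>)
    moreover have "real_vec x = real k *\<^sub>R (\<Sum>a\<in>T. (real_of_int (sum x (tree_cut T a)) / real k) *\<^sub>R arc_vector a)"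
      unfolding x_eq using False by (simp add: scaleR_sum_right)
    ultimately show ?thesis by blast
  qed
qed

end

subsection \<open>Ehrhart series and the gamma expansion\<close>

text \<open>The integer points of a dilated standard simplex; fixing the value 0 off
  \<open>F\<close> makes each point a single function.\<close>

definition simplex_points :: "'a set \<Rightarrow> nat \<Rightarrow> ('a \<Rightarrow> nat) set" where
  "simplex_points F k = {m. (\<forall>a. a \<notin> F \<longrightarrow> m a = 0) \<and> sum m F \<le> k}"

lemma simplex_points_insert_0:
  assumes "finite F" "a \<notin> F"
  shows "simplex_points (insert a F) 0 = simplex_points F 0"
  using assms by (auto simp: simplex_points_def) metis

text \<open>Split by whether \<open>m a\<close> is 0 or can be lowered by 1. In cardinalities this
  is Pascal's rule.\<close>

lemma simplex_points_insert_Suc: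
  assumes "finite F" "a \<notin> F"
  shows "simplex_points (insert a F) (Suc k) =
    simplex_points F (Suc k) \<union> (\<lambda>m. m(a := Suc (m a))) ` simplex_points (insert a F) k" (is "?L = ?R")
proof
  have sum_upd: "(\<Sum>x\<in>F. if x = a then l else m x) = sum m F" for m :: "'a \<Rightarrow> nat" and l
    using assms by (intro sum.cong) auto
  show "?R \<subseteq> ?L"
    using assms by (auto simp: simplex_points_def sum_upd)
  show "?L \<subseteq> ?R"
  proof
    fix m assume m: "m \<in> ?L"
    show "m \<in> ?R"
    proof (cases "m a")
      case 0
      with m assms have "m \<in> simplex_points F (Suc k)" by (auto simp: simplex_points_def) metis
      then show ?thesis by blast
    next
      case (Suc l)
      with m assms have "m(a := l) \<in> simplex_points (insert a F) k"
        by (auto simp: simplex_points_def sum_upd)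
      moreover have "m = (m(a := l))(a := Suc ((m(a := l)) a))"
        using Suc by auto
      ultimately show ?thesis by blast
    qed
  qed
qed

lemma card_simplex_points:
  assumes "finite F"
  shows "finite (simplex_points F k) \<and> card (simplex_points F k) = (k + card F) choose card F"
  using assms
proof (induction F arbitrary: k)
  case empty
  have "simplex_points {} k = {\<lambda>_::'a. 0}" by (auto simp: simplex_points_def)
  then show ?case by simp
next
  case (insert a F)
  show ?case
  proof (induction k)
    case 0
    show ?case using insert by (simp add: simplex_points_insert_0)
  next
    case (Suc k)
    let ?up = "\<lambda>m :: 'a \<Rightarrow> nat. m(a := Suc (m a))"
    have "inj ?up"
    proof (rule injI)
      fix m m' assume eq: "?up m = ?up m'"
      show "m = m'"
      proof
        fix b show "m b = m' b" using fun_cong [OF eq, of b] by (cases "b = a") auto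
      qed
    qed
    moreover have "simplex_points F (Suc k) \<inter> ?up ` simplex_points (insert a F) k = {}"
    proof -
      have "m a = 0" if "m \<in> simplex_points F (Suc k)" for m
        using that insert.hyps by (simp add: simplex_points_def)
      then show ?thesis by fastforce
    qed
    ultimately show ?case
      using Suc insert.IH [of "Suc k"] insert.hyps
      by (simp add: simplex_points_insert_Suc card_Un_disjoint card_image inj_on_subset)
  qed
qed

text \<open>One factor \<open>1 - fps_X\<close> takes differences of consecutive coefficients, which
  lowers \<open>n\<close> by Pascal's rule.\<close>

lemma fps_binomial_times_power:
  "Abs_fps (\<lambda>k. real ((k + n) choose n)) * (1 - fps_X) ^ Suc n = 1"
proof (induction n)
  case 0
  show ?case by (rule fps_ext) (simp add: algebra_simps)
next
  case (Suc n)
  have "Abs_fps (\<lambda>k. real ((k + Suc n) choose Suc n)) * (1 - fps_X)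
      = Abs_fps (\<lambda>k. real ((k + n) choose n))"
  proof (rule fps_ext)
    fix k
    show "fps_nth (Abs_fps (\<lambda>k. real ((k + Suc n) choose Suc n)) * (1 - fps_X)) k
        = fps_nth (Abs_fps (\<lambda>k. real ((k + n) choose n))) k"
      by (cases k) (simp_all add: right_diff_distrib)
  qed
  then show ?case
    using Suc.IH by (simp add: mult.assoc [symmetric])
qed

section \<open>Palindromic polynomials and their gamma expansion\<close>

definition palindromic :: "nat \<Rightarrow> 'a::zero poly \<Rightarrow> bool" where
  "palindromic D h \<longleftrightarrow> degree h \<le> D \<and> (\<forall>i\<le>D. coeff h i = coeff h (D - i))"

lemma palindromic_coeff: "palindromic D h \<Longrightarrow> i \<le> D \<Longrightarrow> coeff h i = coeff h (D - i)"
  unfolding palindromic_def by blast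

lemma palindromic_degree: "palindromic D h \<Longrightarrow> degree h \<le> D"
  unfolding palindromic_def by blast

text \<open>The coefficients are given by a function rather than a polynomial, so that they can be
  shifted in inductions on \<open>D\<close>.\<close>

definition gamma_expansion :: "nat \<Rightarrow> (nat \<Rightarrow> 'a) \<Rightarrow> 'a::comm_ring_1 poly" where
  "gamma_expansion D g = (\<Sum>i\<le>D div 2. smult (g i) ([:0, 1:] ^ i * [:1, 1:] ^ (D - 2 * i)))"

lemma gamma_expansion_0: "gamma_expansion 0 g = [:g 0:]"
  by (simp add: gamma_expansion_def)

lemma gamma_expansion_1: "gamma_expansion (Suc 0) g = [:g 0, g 0:]"
  by (simp add: gamma_expansion_def)

text \<open>Every term except the one for \<open>i = 0\<close> contains a factor x. Taking it out
  leaves an expansion for \<open>D\<close>, so inductions proceed in steps of two.\<close>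

lemma gamma_expansion_Suc_Suc:
  "gamma_expansion (Suc (Suc D)) g = smult (g 0) ([:1, 1:] ^ (D + 2)) + pCons 0 (gamma_expansion D (\<lambda>i. g (Suc i)))"
proof -
  have "gamma_expansion (Suc (Suc D)) g = smult (g 0) ([:1, 1:] ^ (D + 2)) +
      (\<Sum>i\<le>D div 2. smult (g (Suc i)) ([:0, 1:] ^ Suc i * [:1, 1:] ^ (D - 2 * i)))"
  proof -
    have "Suc (Suc D) div 2 = Suc (D div 2)" by simp
    then show ?thesis
      unfolding gamma_expansion_def by (simp add: sum.atMost_Suc_shift del: power_Suc sum.atMost_Suc)
  qed
  also have "(\<Sum>i\<le>D div 2. smult (g (Suc i)) ([:0, 1:] ^ Suc i * [:1, 1:] ^ (D - 2 * i)))
      = [:0, 1:] * gamma_expansion D (\<lambda>i. g (Suc i))"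
    unfolding gamma_expansion_def sum_distrib_left
    by (intro sum.cong refl) (simp only: power_Suc mult_smult_right mult.assoc)
  finally show ?thesis by simp
qed

lemma coeff_linear_power_choose: "coeff ([:1, 1 :: 'a::comm_ring_1:] ^ n) i = of_nat (n choose i)"
proof (induction n arbitrary: i)
  case 0
  show ?case by (cases i) simp_all
next
  case (Suc n)
  then show ?case by (cases i) (simp_all add: algebra_simps)
qed

lemma coeff_0_gamma_expansion: "coeff (gamma_expansion D g) 0 = g 0"
proof -
  consider "D = 0" | "D = 1" | D' where "D = Suc (Suc D')"
    by (metis One_nat_def not0_implies_Suc)
  then show ?thesis
    by cases (simp_all add: gamma_expansion_0 gamma_expansion_1 gamma_expansion_Suc_Suc
        coeff_linear_power_choose del: power_Suc)
qed

text \<open>Only the terms for \<open>i = 0\<close> and \<open>i = 1\<close> reach degree 1. The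
  bound on \<open>D\<close> ensures that the second one is present.\<close>

lemma coeff_1_gamma_expansion:
  assumes "2 \<le> D"
  shows "coeff (gamma_expansion D g) 1 = of_nat D * g 0 + g 1"
proof -
  obtain D' where D: "D = Suc (Suc D')"
    using assms by (metis Suc_le_D numeral_2_eq_2 Suc_le_mono)
  show ?thesis
    unfolding D gamma_expansion_Suc_Suc
    by (simp add: coeff_linear_power_choose coeff_0_gamma_expansion algebra_simps del: power_Suc)
qed

lemma gamma_expansion_inj:
  assumes "gamma_expansion D g = gamma_expansion D g'" "i \<le> D div 2"
  shows "g i = g' i"
  using assms
proof (induction D arbitrary: g g' i rule: induct_nat_012)
  case (ge2 D)
  have g0: "g 0 = g' 0"
    using ge2.prems(1) coeff_0_gamma_expansion by metis
  then have "gamma_expansion D (\<lambda>i. g (Suc i)) = gamma_expansion D (\<lambda>i. g' (Suc i))"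
    using ge2.prems(1) by (simp add: gamma_expansion_Suc_Suc)
  with g0 ge2 show ?case by (cases i) auto
qed (simp_all add: gamma_expansion_0 gamma_expansion_1)

text \<open>Subtracting the constant coefficient times the top power of 1 + x keeps the symmetry and
  annihilates both end coefficients. Division by x leaves a polynomial palindromic for
  \<open>D\<close>.\<close>

lemma palindromic_gamma_expansion:
  assumes "palindromic D (h :: 'a::comm_ring_1 poly)"
  shows "\<exists>g. h = gamma_expansion D g"
  using assms
proof (induction D arbitrary: h rule: induct_nat_012)
  case 0
  then have "h = [:coeff h 0:]"
    by (auto simp: palindromic_def poly_eq_iff coeff_pCons coeff_eq_0 split: nat.split)
  then show ?case by (metis gamma_expansion_0)
next
  case 1
  then have "coeff h 0 = coeff h 1" "degree h \<le> 1"
    using palindromic_coeff [of "Suc 0" h 0] palindromic_degree [of "Suc 0" h] by simp_all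
  then have "h = [:coeff h 0, coeff h 0:]"
    by (auto simp: poly_eq_iff coeff_pCons coeff_eq_0 split: nat.split)
  then show ?case by (metis gamma_expansion_1)
next
  case (ge2 D)
  define h0 where "h0 = coeff h 0"
  define q where "q = h - smult h0 ([:1, 1:] ^ (D + 2))"
  define r where "r = poly_shift 1 q"
  have coeff_q: "coeff q i = coeff h i - h0 * of_nat (D + 2 choose i)" for i
    by (simp add: q_def coeff_linear_power_choose del: power_Suc)
  have h: "coeff h i = 0" if "D + 2 < i" for i
    using palindromic_degree [OF ge2.prems] that by (intro coeff_eq_0) simp
  have h_sym: "coeff h i = coeff h (D + 2 - i)" if "i \<le> D + 2" for i
    using palindromic_coeff [OF ge2.prems, of i] that by simp
  have q_sym: "coeff q i = coeff q (D + 2 - i)" if "i \<le> D + 2" for i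
    unfolding coeff_q using h_sym [OF that] binomial_symmetric [OF that] by simp
  have q0: "coeff q 0 = 0" by (simp add: coeff_q h0_def)
  have q_top: "coeff q i = 0" if "D + 2 \<le> i" for i
  proof (cases "i = D + 2")
    case True
    then show ?thesis using q_sym [of i] q0 by simp
  next
    case False
    then show ?thesis using that h by (simp add: coeff_q binomial_eq_0)
  qed
  have coeff_r: "coeff r i = coeff q (Suc i)" for i
    by (simp add: r_def coeff_poly_shift)
  have "palindromic D r"
    unfolding palindromic_def
  proof (intro conjI allI impI)
    show "degree r \<le> D"
      by (rule degree_le) (simp add: coeff_r q_top)
    show "coeff r i = coeff r (D - i)" if "i \<le> D" for i
      using q_sym [of "Suc i"] that by (simp add: coeff_r Suc_diff_le)
  qed
  then obtain g where g: "r = gamma_expansion D g"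
    using ge2.IH by blast
  have "q = pCons 0 r"
    by (simp add: poly_eq_iff coeff_pCons coeff_r q0 split: nat.split)
  then have "h = gamma_expansion (Suc (Suc D)) (case_nat h0 g)"
    by (simp add: gamma_expansion_Suc_Suc q_def algebra_simps flip: g)
  then show ?case by blast
qed

lemma gamma_polynomial_correct:
  assumes "palindromic D h"
  shows "degree (gamma_polynomial D h) \<le> D div 2"
    and "gamma_expansion D (coeff (gamma_polynomial D h)) = h"
proof -
  obtain f where f: "h = gamma_expansion D f"
    using palindromic_gamma_expansion [OF assms] by blast
  \<comment> \<open>The values of \<open>f\<close> beyond \<open>D div 2\<close> are arbitrary;
    truncation gives a polynomial of the required degree.\<close>
  define g where "g = (\<Sum>i\<le>D div 2. monom (f i) i)"
  have coeff_g: "coeff g i = (if i \<le> D div 2 then f i else 0)" for i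
    by (simp add: g_def coeff_sum)
  have "\<exists>!g. degree g \<le> D div 2 \<and> h = gamma_expansion D (coeff g)"
  proof (intro ex1I conjI)
    show "degree g \<le> D div 2"
      by (rule degree_le) (simp add: coeff_g)
    show "h = gamma_expansion D (coeff g)"
      unfolding f gamma_expansion_def by (intro sum.cong) (auto simp: coeff_g)
    fix g' assume g': "degree g' \<le> D div 2 \<and> h = gamma_expansion D (coeff g')"
    show "g' = g"
    proof (rule poly_eqI)
      fix i show "coeff g' i = coeff g i"
      proof (cases "i \<le> D div 2")
        case True
        then show ?thesis using gamma_expansion_inj [of D "coeff g'" f i] g' f by (simp add: coeff_g)
      next
        case False
        then show ?thesis using g' by (simp add: coeff_g coeff_eq_0)
      qed
    qed
  qed
  from theI' [OF this]
  show "degree (gamma_polynomial D h) \<le> D div 2"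
    and "gamma_expansion D (coeff (gamma_polynomial D h)) = h"
    unfolding gamma_polynomial_def gamma_expansion_def by metis+
qed

text \<open>The denominator is a unit among power series, so the defining quotient can be checked as
  a product.\<close>

lemma h_star_polynomial_unique:
  assumes "ehrhart_series P * (1 - fps_X) ^ nat (aff_dim P + 1) = fps_of_poly h"
  shows "h_star_polynomial P = h"
  unfolding h_star_polynomial_def
proof (rule the_equality)
  have unit: "fps_nth ((1 - fps_X :: real fps) ^ n) 0 \<noteq> 0" for n
    by (simp add: fps_power_zeroth)
  have eq: "a = b / (1 - fps_X) ^ n \<longleftrightarrow> a * (1 - fps_X) ^ n = b" for a b :: "real fps" and n
  proof -
    have inv: "inverse ((1 - fps_X :: real fps) ^ n) * (1 - fps_X) ^ n = 1"
      using unit by (rule inverse_mult_eq_1)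
    have "a = b * inverse ((1 - fps_X) ^ n) \<longleftrightarrow> a * (1 - fps_X) ^ n = b"
    proof
      assume b: "a * (1 - fps_X) ^ n = b"
      have "b * inverse ((1 - fps_X) ^ n) = a * (inverse ((1 - fps_X) ^ n) * (1 - fps_X) ^ n)"
        unfolding b [symmetric] by (simp only: mult_ac)
      then show "a = b * inverse ((1 - fps_X) ^ n)" by (simp only: inv mult_1_right)
    qed (simp only: mult.assoc inv mult_1_right)
    then show ?thesis by (simp only: fps_divide_unit [OF unit])
  qed
  show "ehrhart_series P = fps_of_poly h / (1 - fps_X) ^ nat (aff_dim P + 1)"
    using assms by (simp add: eq)
  fix h' assume "ehrhart_series P = fps_of_poly h' / (1 - fps_X) ^ nat (aff_dim P + 1)"
  then have "fps_of_poly h' = fps_of_poly h"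
    using assms by (simp add: eq)
  then show "h' = h" by simp
qed

subsection \<open>Half-open cones and the h-star-polynomial\<close>

text \<open>Integer points, up to height \<open>k\<close>, of the cone of \<open>T\<close> in cut
  coordinates. For \<open>e\<close> with values 0 and 1 the cone is half-open: facets with value 1
  are removed.\<close>

definition lattice_cone :: "('v::finite \<times> 'v) set \<Rightarrow> ('v \<times> 'v \<Rightarrow> nat) \<Rightarrow> nat \<Rightarrow> ('v \<Rightarrow> int) set" where
  "lattice_cone T e k = {x. sum x UNIV = 0 \<and> (\<forall>a\<in>T. int (e a) \<le> sum x (tree_cut T a)) \<and>
     (\<Sum>a\<in>T. sum x (tree_cut T a)) \<le> int k}"

text \<open>Cut sums are integral coordinates by unimodularity; subtracting \<open>e\<close> from
  them turns the cone up to height \<open>k\<close> into a standard simplex dilated by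
  \<open>k - sum e T\<close>.\<close>

lemma card_lattice_cone:
  fixes T :: "('v::finite \<times> 'v) set"
  assumes T: "spanning_tree T"
  shows "finite (lattice_cone T e k)"
    and "card (lattice_cone T e k) = (if sum e T \<le> k then (k - sum e T + card T) choose card T else 0)"
proof -
  have "finite (lattice_cone T e k) \<and>
    card (lattice_cone T e k) = (if sum e T \<le> k then (k - sum e T + card T) choose card T else 0)"
  proof (cases "sum e T \<le> k")
    case False
    have "lattice_cone T e k = {}"
    proof (rule equals0I)
      fix x assume x: "x \<in> lattice_cone T e k"
      then have "(\<Sum>a\<in>T. int (e a)) \<le> (\<Sum>a\<in>T. sum x (tree_cut T a))"
        by (intro sum_mono) (simp add: lattice_cone_def)
      also have "\<dots> \<le> int k" using x by (simp add: lattice_cone_def)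
      finally have "int (sum e T) \<le> int k" by simp
      with False show False by simp
    qed
    with False show ?thesis by simp
  next
    case True
    define f where "f m = boundary T (\<lambda>a. int (m a + e a))" for m
    have cut_f: "sum (f m) (tree_cut T a) = int (m a + e a)" if "a \<in> T" for m a
      unfolding f_def by (rule sum_boundary_cut [OF T that])
    have sum_cut_f: "(\<Sum>a\<in>T. sum (f m) (tree_cut T a)) = int (sum m T + sum e T)" for m
      by (simp add: cut_f sum.distrib)
    have "bij_betw f (simplex_points T (k - sum e T)) (lattice_cone T e k)"
    proof (rule bij_betw_imageI)
      show "inj_on f (simplex_points T (k - sum e T))"
      proof (intro inj_onI ext)
        fix m m' a
        assume m: "m \<in> simplex_points T (k - sum e T)" "m' \<in> simplex_points T (k - sum e T)"
          and eq: "f m = f m'"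
        show "m a = m' a"
        proof (cases "a \<in> T")
          case True
          then show ?thesis using cut_f [OF True, of m] cut_f [OF True, of m'] eq by simp
        next
          case False
          with m show ?thesis unfolding simplex_points_def mem_Collect_eq by metis
        qed
      qed
      show "f ` simplex_points T (k - sum e T) = lattice_cone T e k"
      proof (intro subset_antisym subsetI)
        fix x assume "x \<in> f ` simplex_points T (k - sum e T)"
        then obtain m where m: "x = f m" "sum m T \<le> k - sum e T"
          by (auto simp: simplex_points_def)
        have "sum (f m) UNIV = 0" unfolding f_def by (rule sum_boundary_UNIV)
        with m True show "x \<in> lattice_cone T e k"
          unfolding lattice_cone_def m(1) mem_Collect_eq sum_cut_f of_nat_le_iff by (simp add: cut_f)
      next
        fix x assume x: "x \<in> lattice_cone T e k"
        define m where "m a = (if a \<in> T then nat (sum x (tree_cut T a) - int (e a)) else 0)" for a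
        have m: "int (m a + e a) = sum x (tree_cut T a)" if "a \<in> T" for a
          using x that by (simp add: m_def lattice_cone_def)
        have "f m = boundary T (\<lambda>a. sum x (tree_cut T a))"
          unfolding f_def boundary_def by (intro ext sum.cong refl) (simp only: m)
        also have "\<dots> = x"
          using x by (intro boundary_cut T) (simp add: lattice_cone_def)
        finally have fm: "f m = x" .
        have "int (sum m T + sum e T) \<le> int k"
          using x unfolding sum_cut_f [symmetric] fm by (simp add: lattice_cone_def)
        then have "sum m T \<le> k - sum e T" by linarith
        then have "m \<in> simplex_points T (k - sum e T)"
          unfolding simplex_points_def by (simp add: m_def)
        with fm show "x \<in> f ` simplex_points T (k - sum e T)" by blast
      qed
    qed
    then show ?thesis
      using card_simplex_points [of T "k - sum e T"] True
      by (simp add: bij_betw_finite flip: bij_betw_same_card)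
  qed
  then show "finite (lattice_cone T e k)"
    and "card (lattice_cone T e k) = (if sum e T \<le> k then (k - sum e T + card T) choose card T else 0)"
    by auto
qed

definition lattice_points :: "(real ^ 'v::finite) set \<Rightarrow> nat \<Rightarrow> ('v \<Rightarrow> int) set" where
  "lattice_points P k = {x. real_vec x \<in> (\<lambda>p. real k *\<^sub>R p) ` P}"

lemma ehrhart_series_nth: "fps_nth (ehrhart_series P) k = real (card (lattice_points P k))"
proof -
  have "(\<lambda>p. real k *\<^sub>R p) ` P \<inter> {x. \<forall>i. x $ i \<in> \<int>} = real_vec ` lattice_points P k"
  proof (intro subset_antisym subsetI)
    fix p assume p: "p \<in> (\<lambda>p. real k *\<^sub>R p) ` P \<inter> {x. \<forall>i. x $ i \<in> \<int>}"
    then have eq: "p = real_vec (\<lambda>i. \<lfloor>p $ i\<rfloor>)"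
      by (simp add: vec_eq_iff)
    moreover have "(\<lambda>i. \<lfloor>p $ i\<rfloor>) \<in> lattice_points P k"
      unfolding lattice_points_def mem_Collect_eq eq [symmetric] using p by blast
    ultimately show "p \<in> real_vec ` lattice_points P k"
      by (rule image_eqI)
  next
    fix p assume "p \<in> real_vec ` lattice_points P k"
    then obtain x where "p = real_vec x" "real_vec x \<in> (\<lambda>p. real k *\<^sub>R p) ` P"
      by (auto simp: lattice_points_def)
    then show "p \<in> (\<lambda>p. real k *\<^sub>R p) ` P \<inter> {x. \<forall>i. x $ i \<in> \<int>}"
      by simp
  qed
  then show ?thesis
    by (simp add: ehrhart_series_def card_image inj_on_subset [OF inj_real_vec])
qed

lemma one_minus_fps_X_power_nth_1: "fps_nth ((1 - fps_X :: real fps) ^ n) 1 = - real n"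
  by (induction n) (simp_all add: fps_mult_nth_1 fps_power_zeroth algebra_simps)

section \<open>Decomposition of the dilates and palindromicity of the h-star-polynomial\<close>

context network
begin

text \<open>The cut side of \<open>a\<close> contains its head. So for an arc of a tree,
  \<open>\<sigma>\<close> true marks direction towards \<open>r\<close> and \<open>\<sigma>\<close>
  false direction away from it; the marked facets are the removed ones.\<close>

definition turned :: "'v \<Rightarrow> bool \<Rightarrow> ('v \<times> 'v) set \<Rightarrow> 'v \<times> 'v \<Rightarrow> nat" where
  "turned r \<sigma> T a = of_bool ((r \<in> tree_cut T a) = \<sigma>)"

definition tree_poly :: "'v \<Rightarrow> bool \<Rightarrow> real poly" where
  "tree_poly r \<sigma> = (\<Sum>T | optimal_tree T. monom 1 (sum (turned r \<sigma> T) T))"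

lemma optimal_tree_spanning: "optimal_tree T \<Longrightarrow> spanning_tree T"
  by (simp add: optimal_tree_def)

lemma card_optimal_tree: "optimal_tree T \<Longrightarrow> card T = CARD('v) - 1"
  by (intro card_spanning_tree optimal_tree_spanning)

lemma lattice_points_zero_sum:
  assumes "x \<in> lattice_points (root_polytope A) k"
  shows "sum x UNIV = 0"
proof -
  obtain p where p: "p \<in> root_polytope A" "real_vec x = real k *\<^sub>R p"
    using assms by (auto simp: lattice_points_def)
  have "real_of_int (sum x UNIV) = (\<Sum>v\<in>UNIV. real_vec x $ v)" by simp
  also have "\<dots> = real k * (\<Sum>v\<in>UNIV. p $ v)"
    unfolding p by (simp add: sum_distrib_left)
  finally have "real_of_int (sum x UNIV) = 0"
    by (simp only: root_polytope_zero_sum [OF p(1)] mult_zero_right)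
  then show ?thesis by (simp only: of_int_eq_0_iff)
qed

text \<open>The half-open cones cover the zero-sum lattice, and within each cone membership in the
  dilate is a bound on the sum of the cut values.\<close>

lemma lattice_points_eq:
  assumes "A \<noteq> {}"
  shows "lattice_points (root_polytope A) k = (\<Union>T\<in>{T. optimal_tree T}. lattice_cone T (turned r \<sigma> T) k)"
proof (intro subset_antisym subsetI)
  fix x assume x: "x \<in> lattice_points (root_polytope A) k"
  note x0 = lattice_points_zero_sum [OF x]
  obtain T where T: "optimal_tree T"
      and le: "\<And>a. a \<in> T \<Longrightarrow> of_bool ((r \<in> tree_cut T a) = \<sigma>) \<le> sum x (tree_cut T a)"
    using half_open_ex1 [OF x0, of r \<sigma>] by blast
  have "0 \<le> sum x (tree_cut T a)" if "a \<in> T" for a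
    using le [OF that] by (rule order_trans [rotated]) simp
  then have "(\<Sum>a\<in>T. sum x (tree_cut T a)) \<le> int k"
    using x real_vec_in_dilate_iff [OF assms T x0] by (simp add: lattice_points_def)
  then have "x \<in> lattice_cone T (turned r \<sigma> T) k"
    using x0 le by (simp add: lattice_cone_def turned_def)
  with T show "x \<in> (\<Union>T\<in>{T. optimal_tree T}. lattice_cone T (turned r \<sigma> T) k)" by blast
next
  fix x assume "x \<in> (\<Union>T\<in>{T. optimal_tree T}. lattice_cone T (turned r \<sigma> T) k)"
  then obtain T where T: "optimal_tree T" and x: "x \<in> lattice_cone T (turned r \<sigma> T) k" by blast
  have "0 \<le> sum x (tree_cut T a)" if "a \<in> T" for a
  proof -
    have "0 \<le> int (turned r \<sigma> T a)" by simp
    also have "\<dots> \<le> sum x (tree_cut T a)" using x that by (simp add: lattice_cone_def)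
    finally show ?thesis .
  qed
  then show "x \<in> lattice_points (root_polytope A) k"
    using x real_vec_in_dilate_iff [OF assms T] by (simp add: lattice_points_def lattice_cone_def)
qed

lemma lattice_cones_disjoint:
  assumes "optimal_tree T" "optimal_tree U" "T \<noteq> U"
  shows "lattice_cone T (turned r \<sigma> T) k \<inter> lattice_cone U (turned r \<sigma> U) k = {}"
proof (rule equals0I)
  fix x assume x: "x \<in> lattice_cone T (turned r \<sigma> T) k \<inter> lattice_cone U (turned r \<sigma> U) k"
  then have "sum x UNIV = 0" by (simp add: lattice_cone_def)
  from half_open_ex1 [OF this, of r \<sigma>] x assms show False
    unfolding lattice_cone_def turned_def of_nat_of_bool by blast
qed

lemma ehrhart_series_root_polytope:
  assumes "A \<noteq> {}"
  shows "ehrhart_series (root_polytope A) =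
    (\<Sum>T | optimal_tree T. fps_X ^ sum (turned r \<sigma> T) T *
      Abs_fps (\<lambda>k. real ((k + (CARD('v) - 1)) choose (CARD('v) - 1))))"
proof (rule fps_ext)
  fix k
  have "card (lattice_points (root_polytope A) k)
      = (\<Sum>T | optimal_tree T. card (lattice_cone T (turned r \<sigma> T) k))"
    unfolding lattice_points_eq [OF assms, of k r \<sigma>]
    by (intro card_UN_disjoint)
      (auto simp: lattice_cones_disjoint card_lattice_cone optimal_tree_spanning)
  also have "\<dots> = (\<Sum>T | optimal_tree T. if sum (turned r \<sigma> T) T \<le> k
      then (k - sum (turned r \<sigma> T) T + (CARD('v) - 1)) choose (CARD('v) - 1) else 0)"
    by (intro sum.cong refl) (simp add: card_lattice_cone optimal_tree_spanning card_optimal_tree)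
  finally show "fps_nth (ehrhart_series (root_polytope A)) k =
     fps_nth (\<Sum>T | optimal_tree T. fps_X ^ sum (turned r \<sigma> T) T *
      Abs_fps (\<lambda>k. real ((k + (CARD('v) - 1)) choose (CARD('v) - 1)))) k"
    by (auto simp: ehrhart_series_nth fps_sum_nth fps_X_power_mult_nth intro!: sum.cong)
qed

lemma ehrhart_series_times_power:
  assumes "A \<noteq> {}"
  shows "ehrhart_series (root_polytope A) * (1 - fps_X) ^ CARD('v) = fps_of_poly (tree_poly r \<sigma>)"
proof -
  have "Suc (CARD('v) - 1) = CARD('v)" by simp
  then have G: "Abs_fps (\<lambda>k. real ((k + (CARD('v) - 1)) choose (CARD('v) - 1))) * (1 - fps_X) ^ CARD('v) = 1"
    using fps_binomial_times_power [of "CARD('v) - 1"] by (simp only:)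
  have "ehrhart_series (root_polytope A) * (1 - fps_X) ^ CARD('v)
      = (\<Sum>T | optimal_tree T. fps_X ^ sum (turned r \<sigma> T) T)"
    unfolding ehrhart_series_root_polytope [OF assms, of r \<sigma>] sum_distrib_right mult.assoc G
    by simp
  then show ?thesis
    by (simp add: tree_poly_def fps_of_poly_sum fps_of_poly_monom)
qed

text \<open>The left side involves neither \<open>r\<close> nor \<open>\<sigma>\<close>; this
  freedom is the source of the symmetry.\<close>

lemma h_star_root_polytope:
  assumes "A \<noteq> {}"
  shows "h_star_polynomial (root_polytope A) = tree_poly r \<sigma>"
proof (rule h_star_polynomial_unique)
  have "nat (aff_dim (root_polytope A) + 1) = CARD('v)"
    using aff_dim_root_polytope [OF assms] by simp
  then show "ehrhart_series (root_polytope A) * (1 - fps_X) ^ nat (aff_dim (root_polytope A) + 1) =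
      fps_of_poly (tree_poly r \<sigma>)"
    using ehrhart_series_times_power [OF assms] by simp
qed

lemma turned_le:
  assumes "optimal_tree T"
  shows "sum (turned r \<sigma> T) T \<le> CARD('v) - 1"
proof -
  have "sum (turned r \<sigma> T) T \<le> (\<Sum>a\<in>T. 1)"
    by (intro sum_mono) (simp add: turned_def)
  with assms show ?thesis by (simp add: card_optimal_tree)
qed

lemma turned_flip:
  assumes "optimal_tree T"
  shows "sum (turned r True T) T + sum (turned r False T) T = CARD('v) - 1"
proof -
  have "turned r True T a + turned r False T a = 1" for a
    by (simp add: turned_def)
  then show ?thesis
    using assms by (simp add: card_optimal_tree flip: sum.distrib)
qed

text \<open>Passing from \<open>\<sigma>\<close> true to false replaces the number of marked arcs of
  each tree by its complement to \<open>CARD('v) - 1\<close>, while the polynomial stays the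
  same.\<close>

lemma palindromic_h_star:
  assumes "A \<noteq> {}"
  shows "palindromic (CARD('v) - 1) (h_star_polynomial (root_polytope A))"
  unfolding palindromic_def
proof (intro conjI allI impI)
  fix r :: 'v
  let ?D = "CARD('v) - 1" and ?h = "h_star_polynomial (root_polytope A)"
  have coeff_h: "coeff ?h i = (\<Sum>T | optimal_tree T. of_bool (sum (turned r \<sigma> T) T = i))" for i \<sigma>
    unfolding h_star_root_polytope [OF assms, of r \<sigma>] tree_poly_def coeff_sum coeff_monom
    by (simp add: of_bool_def)
  show "degree ?h \<le> ?D"
    unfolding h_star_root_polytope [OF assms, of r True] tree_poly_def
  proof (intro degree_sum_le)
    fix T assume "T \<in> {T. optimal_tree T}"
    then show "degree (monom 1 (sum (turned r True T) T)) \<le> ?D"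
      using order_trans [OF degree_monom_le turned_le] by blast
  qed simp
  fix i assume i: "i \<le> ?D"
  have "(sum (turned r True T) T = i) = (sum (turned r False T) T = ?D - i)" if "optimal_tree T" for T
    using turned_flip [OF that, of r] i by linarith
  then have "(\<Sum>T | optimal_tree T. of_bool (sum (turned r True T) T = i))
      = (\<Sum>T | optimal_tree T. of_bool (sum (turned r False T) T = ?D - i) :: real)"
    by (intro sum.cong) simp_all
  then show "coeff ?h i = coeff ?h (?D - i)"
    unfolding coeff_h [of i True] coeff_h [of "?D - i" False] .
qed

section \<open>The constant and linear coefficients of the h-star-polynomial\<close>

lemma lattice_points_0:
  assumes "A \<noteq> {}"
  shows "lattice_points (root_polytope A) 0 = {\<lambda>_. 0}"
  using zero_in_root_polytope [OF assms]
  by (auto simp: lattice_points_def vec_eq_iff image_iff)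

text \<open>The cut values of such a point are nonnegative integers with sum at most 1: either all
  are 0, or a single 1 selects an arc of the tree.\<close>

lemma lattice_points_1:
  assumes "A \<noteq> {}"
  shows "lattice_points (root_polytope A) 1 = insert (\<lambda>_. 0) ((\<lambda>a v. crossing a {v}) ` A)"
proof (intro subset_antisym subsetI)
  fix x assume "x \<in> insert (\<lambda>_. 0) ((\<lambda>a v. crossing a {v}) ` A)"
  moreover have "real_vec (\<lambda>_. 0) = (0 :: real ^ 'v)" by (simp add: vec_eq_iff)
  moreover have "arc_vector a \<in> root_polytope A" if "a \<in> A" for a
    using that by (auto simp: root_polytope_def intro: hull_inc)
  ultimately show "x \<in> lattice_points (root_polytope A) 1"
    using zero_in_root_polytope [OF assms] by (auto simp: lattice_points_def arc_vector_eq)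
next
  fix x assume "x \<in> lattice_points (root_polytope A) 1"
  \<comment> \<open>\<open>undefined\<close> stands for an arbitrary root vertex.\<close>
  then obtain T where T: "optimal_tree T" and x: "x \<in> lattice_cone T (turned undefined True T) 1"
    unfolding lattice_points_eq [OF assms, of 1 undefined True] by blast
  define z where "z a = sum x (tree_cut T a)" for a
  have z0: "0 \<le> z a" if "a \<in> T" for a
  proof -
    have "0 \<le> int (turned undefined True T a)" by simp
    also have "\<dots> \<le> z a" using x that by (simp add: lattice_cone_def z_def)
    finally show ?thesis .
  qed
  have le: "sum z T \<le> 1" using x by (simp add: lattice_cone_def z_def)
  have xz: "x = boundary T z"
    unfolding z_def using x by (intro boundary_cut [symmetric] optimal_tree_spanning T) (simp add: lattice_cone_def)
  show "x \<in> insert (\<lambda>_. 0) ((\<lambda>a v. crossing a {v}) ` A)"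
  proof (cases "\<exists>a\<in>T. z a \<noteq> 0")
    case False
    then have "x = (\<lambda>_. 0)" unfolding xz by (auto simp: boundary_def)
    then show ?thesis by simp
  next
    case True
    then obtain a where a: "a \<in> T" "z a \<noteq> 0" by blast
    have split: "sum z T = z a + sum z (T - {a})" using a by (simp add: sum.remove)
    have rest: "0 \<le> sum z (T - {a})" using z0 by (intro sum_nonneg) auto
    have "z a = 1" and "sum z (T - {a}) = 0"
      using z0 [OF a(1)] a(2) split rest le by linarith+
    then have "z b = of_bool (b = a) * 1" if "b \<in> T" for b
      using z0 that sum_nonneg_eq_0_iff [of "T - {a}" z] by auto
    then have "x v = boundary T (\<lambda>b. of_bool (b = a) * 1) v" for v
      unfolding xz boundary_def by (intro sum.cong) auto
    then have "x = (\<lambda>v. crossing a {v})"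
      using boundary_single [OF a(1), of 1] by auto
    then show ?thesis using a(1) T by (auto simp: optimal_tree_def)
  qed
qed

lemma coeff_0_h_star:
  assumes "A \<noteq> {}"
  shows "coeff (h_star_polynomial (root_polytope A)) 0 = 1"
proof -
  have "coeff (h_star_polynomial (root_polytope A)) 0
      = fps_nth (ehrhart_series (root_polytope A) * (1 - fps_X) ^ CARD('v)) 0"
    unfolding h_star_root_polytope [OF assms, of undefined True]
      ehrhart_series_times_power [OF assms, of undefined True] by simp
  then show ?thesis
    by (simp add: fps_power_zeroth ehrhart_series_nth lattice_points_0 [OF assms])
qed

text \<open>Without loops, distinct arcs give distinct nonzero vectors, so the polytope has
  \<open>card A + 1\<close> lattice points. The linear term of the denominator subtracts
  \<open>CARD('v)\<close> times the one point of the zeroth dilate.\<close>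

lemma coeff_1_h_star:
  assumes "A \<noteq> {}" and irrefl: "\<And>u. (u, u) \<notin> A"
  shows "coeff (h_star_polynomial (root_polytope A)) 1 = real (card A) + 1 - real CARD('v)"
proof -
  have "inj_on (\<lambda>a v. crossing a {v}) A"
  proof (rule inj_onI)
    fix a b assume a: "a \<in> A" "b \<in> A" and eq: "(\<lambda>v. crossing a {v}) = (\<lambda>v. crossing b {v})"
    have "fst a \<noteq> snd a" "fst b \<noteq> snd b" using a irrefl by (metis prod.collapse)+
    then show "a = b"
      using fun_cong [OF eq, of "fst a"] fun_cong [OF eq, of "snd a"]
      by (auto simp: crossing_def of_bool_def prod_eq_iff split: if_splits)
  qed
  moreover have "(\<lambda>_. 0) \<notin> (\<lambda>a v. crossing a {v}) ` A"
  proof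
    assume "(\<lambda>_. 0) \<in> (\<lambda>a v. crossing a {v}) ` A"
    then obtain a where a: "a \<in> A" "(\<lambda>_. 0) = (\<lambda>v. crossing a {v})" by blast
    then have "fst a = snd a"
      using fun_cong [OF a(2), of "fst a"] by (auto simp: crossing_def split: if_splits)
    with a irrefl show False by (metis prod.collapse)
  qed
  ultimately have "card (lattice_points (root_polytope A) 1) = Suc (card A)"
    unfolding lattice_points_1 [OF assms(1)] by (simp add: card_image)
  moreover have "coeff (h_star_polynomial (root_polytope A)) 1
      = fps_nth (ehrhart_series (root_polytope A) * (1 - fps_X) ^ CARD('v)) 1"
    unfolding h_star_root_polytope [OF assms(1), of undefined True]
      ehrhart_series_times_power [OF assms(1), of undefined True] by simp
  ultimately show ?thesis
    by (simp add: fps_mult_nth_1 one_minus_fps_X_power_nth_1 [unfolded One_nat_def] fps_power_zeroth ehrhart_series_nth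
        lattice_points_0 [OF assms(1)])
qed

end

section \<open>From the graph to its directed edges, and the linear gamma coefficient\<close>

definition arcs :: "'v set set \<Rightarrow> ('v \<times> 'v) set" where
  "arcs E = {(u, v). {u, v} \<in> E}"

lemma symmetric_edge_polytope_eq: "symmetric_edge_polytope E = root_polytope (arcs E)"
proof -
  have "{axis u 1 - axis v 1 | u v. {u, v} \<in> E} = arc_vector ` arcs E"
    by (force simp: arcs_def arc_vector_def insert_commute)
  then show ?thesis
    by (simp add: symmetric_edge_polytope_def root_polytope_def)
qed

text \<open>If no arc crosses \<open>S\<close>, a walk that starts in \<open>S\<close> stays in
  \<open>S\<close>.\<close>

lemma spanning_arcs:
  fixes E :: "'v::finite set set"
  assumes "connected_graph E"
  shows "spanning (arcs E)"
  unfolding spanning_def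
proof (intro allI impI, rule ccontr, elim conjE)
  fix S :: "'v set"
  assume "S \<noteq> {}" "S \<noteq> UNIV" and no: "\<not> (\<exists>a\<in>arcs E. crossing a S \<noteq> 0)"
  then obtain u w where uw: "u \<in> S" "w \<notin> S" by blast
  have "(u, w) \<in> {(x, y). {x, y} \<in> E}\<^sup>*"
    using assms by (simp add: connected_graph_def)
  then have "w \<in> S"
  proof (induction rule: rtrancl_induct)
    case (step y z)
    then have "(y, z) \<in> arcs E" by (simp add: arcs_def)
    with no have "crossing (y, z) S = 0" by blast
    with step.IH show ?case by (auto simp: crossing_def split: if_splits)
  qed (fact uw)
  with uw show False by simp
qed

lemma card_arcs:
  fixes E :: "'v::finite set set"
  assumes "simple_graph E"
  shows "card (arcs E) = 2 * card E"
proof -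
  have "arcs E = (\<Union>e\<in>E. {(u, v). {u, v} = e})" by (auto simp: arcs_def)
  also have "card \<dots> = (\<Sum>e\<in>E. card {(u, v). {u, v} = e})"
    by (intro card_UN_disjoint) auto
  also have "\<dots> = (\<Sum>e\<in>E. 2)"
  proof (intro sum.cong refl)
    fix e assume "e \<in> E"
    then obtain p q where "p \<noteq> q" "e = {p, q}" using assms by (auto simp: simple_graph_def)
    then have "{(u, v). {u, v} = e} = {(p, q), (q, p)}" by (auto simp: doubleton_eq_iff)
    with \<open>p \<noteq> q\<close> show "card {(u, v). {u, v} = e} = 2" by simp
  qed
  finally show ?thesis by simp
qed

theorem theorem4p1:
  fixes E :: "'v::finite set set"
  assumes "simple_graph E" and "connected_graph E"
  shows "coeff (gamma_polynomial (CARD('v) - 1)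
            (h_star_polynomial (symmetric_edge_polytope E))) 1
         = 2 * (real (card E) - real CARD('v) + 1)"
proof (cases "CARD('v) = 1")
  case True
  \<comment> \<open>The polytope is empty, of dimension -1, so \<open>h\<^sup>*\<close> is 0 rather than 1.\<close>
  then have "\<exists>x :: 'v. UNIV = {x}"
    by (simp add: card_1_singleton_iff)
  then have "u = v" for u v :: 'v by (metis UNIV_I singletonD)
  with assms(1) have E: "E = {}" by (auto simp: simple_graph_def)
  have "ehrhart_series (symmetric_edge_polytope E) = 0"
    by (rule fps_ext) (simp add: E symmetric_edge_polytope_def ehrhart_series_def)
  then have "h_star_polynomial (symmetric_edge_polytope E) = 0"
    by (intro h_star_polynomial_unique) simp
  \<comment> \<open>With \<open>D = 0\<close> the degree bound makes the gamma polynomial constant,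
    in agreement with 2 * (0 - 1 + 1) = 0.\<close>
  moreover have "palindromic 0 (0 :: real poly)"
    by (simp add: palindromic_def)
  ultimately have "degree (gamma_polynomial (CARD('v) - 1)
      (h_star_polynomial (symmetric_edge_polytope E))) = 0"
    using gamma_polynomial_correct(1) [of 0 0] True by simp
  then show ?thesis
    using True E by (simp add: coeff_eq_0)
next
  case False
  let ?A = "arcs E" and ?D = "CARD('v) - 1"
  let ?h = "h_star_polynomial (symmetric_edge_polytope E)"
  have card2: "2 \<le> CARD('v)"
    using False zero_less_card_finite [where 'a = 'v] by linarith
  \<comment> \<open>With two vertices a singleton is a proper set, which some arc must
    cross.\<close>
  have "{undefined :: 'v} \<noteq> UNIV"
    using card2 by (metis card.empty card_insert_disjoint empty_iff finite.emptyI One_nat_def False)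
  with spanning_arcs [OF assms(2)] have ne: "?A \<noteq> {}"
    unfolding spanning_def by blast
  have irrefl: "(u, u) \<notin> ?A" for u
    using assms(1) by (auto simp: arcs_def simple_graph_def)
  have "\<exists>c. network ?A c"
    using spanning_arcs [OF assms(2)] by (intro ex_network) (auto simp: arcs_def insert_commute)
  then obtain c where "network ?A c" ..
  then interpret network ?A c .
  have pal: "palindromic ?D ?h"
    unfolding symmetric_edge_polytope_eq by (rule palindromic_h_star [OF ne])
  have h0: "coeff ?h 0 = 1"
    unfolding symmetric_edge_polytope_eq by (rule coeff_0_h_star [OF ne])
  have h1: "coeff ?h 1 = 2 * real (card E) + 1 - real CARD('v)"
    unfolding symmetric_edge_polytope_eq coeff_1_h_star [OF ne irrefl] card_arcs [OF assms(1)] by simp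
  note \<gamma> = gamma_polynomial_correct [OF pal]
  show ?thesis
  proof (cases "?D = 1")
    case True
    \<comment> \<open>For \<open>?D = 1\<close> the expansion has no linear term. Palindromicity
      makes both coefficients of \<open>?h\<close> equal to 1, which forces
      \<open>card E = 1\<close>, so the right side is 0 as well.\<close>
    then have "coeff (gamma_polynomial ?D ?h) 1 = 0"
      using \<gamma>(1) by (intro coeff_eq_0) simp
    moreover have "coeff ?h 0 = coeff ?h 1"
      using palindromic_coeff [OF pal, of 0] True by simp
    ultimately show ?thesis
      using h0 h1 True by simp
  next
    case False
    with card2 have D2: "2 \<le> ?D" by linarith
    have "coeff (gamma_polynomial ?D ?h) 0 = 1"
      using coeff_0_gamma_expansion [of ?D "coeff (gamma_polynomial ?D ?h)"] h0 unfolding \<gamma>(2) by simp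
    \<comment> \<open>Solving for the linear gamma coefficient subtracts \<open>?D\<close> from
      \<open>coeff ?h 1\<close>.\<close>
    moreover have "coeff ?h 1 = real ?D * coeff (gamma_polynomial ?D ?h) 0 + coeff (gamma_polynomial ?D ?h) 1"
      using coeff_1_gamma_expansion [OF D2, of "coeff (gamma_polynomial ?D ?h)"] unfolding \<gamma>(2) by simp
    ultimately show ?thesis
      using h1 card2 by (simp add: of_nat_diff)
  qed
qed

end
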